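(* Let $g$ be a totally positive function of Gaussian type. Let $f\in V^\infty(g)\setminus\{0\}$ be real-valued and let $(N_f,m_f)$ be its set of real zeros counted with multiplicities. Then $D^-(N_f,m_f)\le1$. In particular, if $\Lambda\subseteq\mathbb{R}$ satisfies $D^-(\Lambda)>1$, then $\Lambda$ is a uniqueness set for $V^\infty(g)$, i.e. every $f\in V^\infty(g)$ vanishing on $\Lambda$ is identically zero.
   Context: $g$ is totally positive of Gaussian type if $\hat g(\xi)=\prod_{j=1}^n(1+2\pi i\delta_j\xi)^{-1}e^{-c\xi^2}$ with $\delta_j\in\mathbb{R}$, $c>0$, $n\in\mathbb{N}\cup\{0\}$ (Fourier transform $\hat g(\xi)=\int g(x)e^{-2\pi ix\xi}dx$). $V^\infty(g)=\{\sum_{k\in\mathbb{Z}}c_kg(\cdot-k):c\in\ell^\infty(\mathbb{Z})\}$. $m_f(x)$ is the order of vanishing of $f$ at a zero $x$. $D^-(N,m)=\liminf_{r\to\infty}\inf_{x\in\mathbb{R}}\frac{1}{2r}\sum_{\lambda\in N\cap[x-r,x+r]}m(\lambda)$, and $D^-(\Lambda)$ is this with $m\equiv1$. *)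

theory Defs
  imports "HOL-Analysis.Analysis"
begin

definition fourier :: "(real \<Rightarrow> real) \<Rightarrow> real \<Rightarrow> complex" where
  "fourier g \<xi> = integral\<^sup>L lborel (\<lambda>x. complex_of_real (g x) * cis (- 2 * pi * x * \<xi>))"

definition TP_gaussian_type :: "(real \<Rightarrow> real) \<Rightarrow> bool" where
  "TP_gaussian_type g \<longleftrightarrow> continuous_on UNIV g \<and> integrable lborel g \<and>
     (\<exists>(n::nat) (\<delta>::nat \<Rightarrow> real) (c::real). c > 0 \<and>
        (\<forall>\<xi>. fourier g \<xi> =
           (\<Prod>j<n. inverse (1 + 2 * pi * \<i> * complex_of_real (\<delta> j * \<xi>)))
           * complex_of_real (exp (- c * \<xi>\<^sup>2))))"

definition V_infty :: "(real \<Rightarrow> real) \<Rightarrow> (real \<Rightarrow> complex) set" where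
  "V_infty g = {f. \<exists>c::int \<Rightarrow> complex. bounded (range c) \<and>
       (\<forall>x. f x = (\<Sum>\<^sub>\<infinity>k\<in>UNIV. c k * complex_of_real (g (x - real_of_int k))))}"

definition vanishing_order :: "(real \<Rightarrow> real) \<Rightarrow> real \<Rightarrow> nat" where
  "vanishing_order f x = (LEAST n. (deriv ^^ n) f x \<noteq> 0)"

definition weighted_count :: "real set \<Rightarrow> (real \<Rightarrow> nat) \<Rightarrow> real set \<Rightarrow> ereal" where
  "weighted_count N m I =
     (if finite (N \<inter> I) then ereal (\<Sum>y\<in>N \<inter> I. real (m y)) else \<infinity>)"

definition lower_density :: "real set \<Rightarrow> (real \<Rightarrow> nat) \<Rightarrow> ereal" where
  "lower_density N m =
     Liminf at_top (\<lambda>r::real. INF x. weighted_count N m {x - r .. x + r} / ereal (2 * r))"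

definition lower_density_set :: "real set \<Rightarrow> ereal" where
  "lower_density_set \<Lambda> = lower_density \<Lambda> (\<lambda>_. 1)"

end

theory Submission
  imports Defs "HOL-Probability.Probability" "HOL-Complex_Analysis.Complex_Analysis"
    "HOL-Real_Asymp.Real_Asymp"
begin

text \<open>
  By uniqueness of the Fourier transform, \<open>g\<close> arises from a Gaussian \<open>\<phi>\<close> by applying the inverses
  of the operators \<open>I + \<delta>\<^sub>j D\<close>, each of which is an average of translates over the exponential
  distribution. Hence \<open>f = \<Sum> c\<^sub>k g(\<cdot> - k)\<close> arises in the same way from \<open>h = \<Sum> c\<^sub>k \<phi>(\<cdot> - k)\<close>. Since
  \<open>f + \<delta> f' = \<delta> e\<^bsup>-x/\<delta>\<^esup> (e\<^bsup>x/\<delta>\<^esup> f)'\<close>, Rolle's theorem shows that each operator \<open>I + \<delta>\<^sub>j D\<close> loses at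
  most one zero per interval, so the zeros of \<open>h\<close> are at least as dense as those of \<open>f\<close>.

  For the Gaussian \<open>e\<^bsup>-a x\<^sup>2\<^esup>\<close> the entire function \<open>F(z) = e\<^bsup>a z\<^sup>2\<^esup> h(z)\<close> has period \<open>\<i> \<pi> / a\<close> and
  satisfies \<open>|F(z)| \<le> C e\<^bsup>a (Re z)\<^sup>2\<^esup>\<close>. Dividing \<open>F\<close> by a product of functions \<open>sinh (a (z - y))\<close> over its
  real zeros \<open>y\<close> in \<open>|Re z| < s\<close> and applying the maximum principle to this strip gains a factor
  \<open>e\<^bsup>-a (s - |y|)\<^esup>\<close> for every zero. If there are more than \<open>2 L\<close> zeros in each layer
  \<open>j L < |y| < (j + 1) L\<close>, the gain beats the growth \<open>e\<^bsup>a s\<^sup>2\<^esup>\<close> as \<open>s \<rightarrow> \<infinity>\<close>, so \<open>F = 0\<close>.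
\<close>

section \<open>Zeros counted with multiplicity\<close>

text \<open>Multiplicities are only bounded from below, so a point where all derivatives vanish causes no
  trouble.\<close>

definition vanishes_on :: "('a::real_normed_field \<Rightarrow> 'a) \<Rightarrow> 'a multiset \<Rightarrow> bool" where
  "vanishes_on f Z \<longleftrightarrow> (\<forall>y. \<forall>i<count Z y. (deriv ^^ i) f y = 0)"

definition has_zeros :: "(real \<Rightarrow> real) \<Rightarrow> nat \<Rightarrow> real set \<Rightarrow> bool" where
  "has_zeros f N I \<longleftrightarrow> (\<exists>Z. vanishes_on f Z \<and> size Z = N \<and> set_mset Z \<subseteq> I)"

lemma vanishes_on_subset_mset: "vanishes_on f Z \<Longrightarrow> Y \<subseteq># Z \<Longrightarrow> vanishes_on f Y"
  unfolding vanishes_on_def by (meson mset_subset_eq_count order_less_le_trans)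

lemma vanishes_on_mset_set: "(\<And>y. y \<in> S \<Longrightarrow> f y = 0) \<Longrightarrow> vanishes_on f (mset_set S)"
  by (cases "finite S") (auto simp: vanishes_on_def count_mset_set')

lemma vanishes_on_add_disjoint:
  assumes "vanishes_on f Y" "vanishes_on f Z" "set_mset Y \<inter> set_mset Z = {}"
  shows "vanishes_on f (Y + Z)"
proof -
  have "count (Y + Z) y = count Y y \<or> count (Y + Z) y = count Z y" for y
    using assms(3) by (cases "y \<in># Y") (auto simp: not_in_iff)
  then show ?thesis
    using assms(1,2) unfolding vanishes_on_def by metis
qed

lemma has_zeros_add:
  assumes "has_zeros f M I" "has_zeros f N J" "I \<inter> J = {}"
  shows "has_zeros f (M + N) (I \<union> J)"
proof -
  obtain Y Z where "vanishes_on f Y" "size Y = M" "set_mset Y \<subseteq> I"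
    and "vanishes_on f Z" "size Z = N" "set_mset Z \<subseteq> J"
    using assms(1,2) unfolding has_zeros_def by blast
  then show ?thesis
    using assms(3) unfolding has_zeros_def
    by (intro exI[of _ "Y + Z"]) (auto intro!: vanishes_on_add_disjoint)
qed

lemma has_zeros_mono:
  assumes "has_zeros f N I" "M \<le> N" "I \<subseteq> J"
  shows "has_zeros f M J"
proof -
  have "\<exists>Y. Y \<subseteq># Z \<and> size Y = M" if "M \<le> size Z" for Z :: "real multiset"
    using that
  proof (induction Z)
    case (add y Z)
    then show ?case
      by (metis le_Suc_eq multi_psub_of_add_self size_add_mset subset_mset.dual_order.trans
          subset_mset.less_imp_le subset_mset.order_refl)
  qed auto
  then show ?thesis
    using assms unfolding has_zeros_def
    by (metis set_mset_mono subset_trans vanishes_on_subset_mset)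
qed

lemma has_zeros_if_le_weighted_count:
  assumes count: "ereal (real N) \<le> weighted_count S m I"
    and zero: "\<And>y. y \<in> S \<Longrightarrow> f y = 0"
    and mult: "\<And>y i. y \<in> S \<Longrightarrow> i < m y \<Longrightarrow> (deriv ^^ i) f y = 0"
  shows "has_zeros f N I"
proof (cases "finite (S \<inter> I)")
  case True
  define Z where "Z = (\<Sum>y\<in>S \<inter> I. replicate_mset (m y) y)"
  have count_Z: "count Z y = (if y \<in> S \<inter> I then m y else 0)" for y
    using True by (simp add: Z_def count_sum if_distrib sum.delta cong: if_cong)
  have "has_zeros f (size Z) I"
    unfolding has_zeros_def
  proof (intro exI[of _ Z] conjI refl)
    show "vanishes_on f Z"
      using mult by (auto simp: vanishes_on_def count_Z split: if_splits)
    show "set_mset Z \<subseteq> I"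
      using count_Z by (auto simp flip: count_greater_zero_iff split: if_splits)
  qed
  moreover have "N \<le> size Z"
    using count True by (simp add: weighted_count_def Z_def size_multiset_sum flip: of_nat_sum)
  ultimately show ?thesis
    using has_zeros_mono by blast
next
  case False
  then obtain F where "F \<subseteq> S \<inter> I" "finite F" "card F = N"
    using infinite_arbitrarily_large by metis
  then show ?thesis
    using zero unfolding has_zeros_def
    by (intro exI[of _ "mset_set F"]) (auto intro: vanishes_on_mset_set)
qed

lemma eventually_less_weighted_count:
  assumes "ereal q < lower_density S m"
  shows "\<forall>\<^sub>F r in at_top. \<forall>x. ereal (2 * r * q) < weighted_count S m {x - r..x + r}"
proof -
  have "\<forall>\<^sub>F r in at_top. ereal q < (INF x. weighted_count S m {x - r..x + r} / ereal (2 * r))"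
    using assms less_LiminfD unfolding lower_density_def by blast
  then show ?thesis
    using eventually_gt_at_top[of 0]
  proof eventually_elim
    case (elim r)
    show ?case
    proof
      fix x
      have "ereal q < weighted_count S m {x - r..x + r} / ereal (2 * r)"
        using elim(1) by (meson INF_lower UNIV_I less_le_trans)
      then show "ereal (2 * r * q) < weighted_count S m {x - r..x + r}"
        using elim(2) by (auto simp: weighted_count_def field_simps split: if_splits)
    qed
  qed
qed

lemma has_zeros_if_lower_density_gt_1:
  fixes d :: nat
  assumes dens: "lower_density S m > 1"
    and zero: "\<And>y. y \<in> S \<Longrightarrow> f y = 0"
    and mult: "\<And>y i. y \<in> S \<Longrightarrow> i < m y \<Longrightarrow> (deriv ^^ i) f y = 0"
  obtains r :: real and M :: nat
  where "r > 0" "real M > 2 * r" "\<And>x. has_zeros f (M + d) {x - r..x + r}"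
proof -
  obtain q where q: "1 < q" "ereal q < lower_density S m"
    using ereal_dense2[OF dens] by (metis ereal_less_eq(3) not_le one_ereal_def)
  have "\<forall>\<^sub>F r in at_top. r \<ge> max 1 ((d + 1) / (2 * (q - 1)))"
    by (rule eventually_ge_at_top)
  then obtain r where count: "\<And>x. ereal (2 * r * q) < weighted_count S m {x - r..x + r}"
    and r: "r \<ge> 1" "(d + 1) / (2 * (q - 1)) \<le> r"
    using eventually_happens'[OF _ eventually_conj[OF eventually_less_weighted_count[OF q(2)]]]
    by (auto simp: trivial_limit_at_top_linorder)
  define M where "M = nat \<lfloor>2 * r\<rfloor> + 1"
  have M: "real M > 2 * r" "real M \<le> 2 * r + 1"
    using r(1) unfolding M_def by linarith+
  have "d + 1 \<le> r * (2 * (q - 1))"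
    using r(2) q(1) by (simp add: pos_divide_le_eq)
  then have "real (M + d) \<le> 2 * r * q"
    using M(2) by (simp add: algebra_simps)
  then have "ereal (real (M + d)) \<le> weighted_count S m {x - r..x + r}" for x
    using count[of x] by (meson ereal_less_eq(3) less_imp_le order_trans)
  then have "has_zeros f (M + d) {x - r..x + r}" for x
    by (rule has_zeros_if_le_weighted_count[OF _ zero mult])
  then show ?thesis
    using that[of r M] M(1) r(1) by simp
qed

lemma has_zeros_layer:
  assumes zeros: "\<And>x. has_zeros f M {x - r..x + r}" and "r > 0" "2 * r < L"
  shows "has_zeros f (2 * M) {y. real j * L < \<bar>y\<bar> \<and> \<bar>y\<bar> < (real j + 1) * L}"
proof -
  define t where "t = (real j + 1 / 2) * L"
  have t: "t - r > real j * L" "t + r < (real j + 1) * L" "real j * L \<ge> 0"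
    using assms(2,3) by (auto simp: t_def algebra_simps)
  then have "has_zeros f (M + M) ({t - r..t + r} \<union> {- t - r..- t + r})"
    by (intro has_zeros_add zeros) auto
  then show ?thesis
    by (rule has_zeros_mono) (use t in \<open>auto simp: abs_if\<close>)
qed

lemma vanishes_on_layers:
  assumes zeros: "\<And>j. has_zeros f N {y. real j * L < \<bar>y\<bar> \<and> \<bar>y\<bar> < (real j + 1) * L}" and "L > 0"
  obtains Z where "vanishes_on f Z" "size Z = N * n" "\<And>y. y \<in># Z \<Longrightarrow> \<bar>y\<bar> < real n * L"
    "(\<Sum>y\<in>#Z. \<bar>y\<bar>) \<le> N * L * (real n * (real n + 1) / 2)"
proof -
  have "\<exists>Z. vanishes_on f Z \<and> size Z = N * n \<and> (\<forall>y\<in>#Z. \<bar>y\<bar> < real n * L) \<and>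
      (\<Sum>y\<in>#Z. \<bar>y\<bar>) \<le> N * L * (real n * (real n + 1) / 2)"
  proof (induction n)
    case 0
    then show ?case
      by (intro exI[of _ "{#}"]) (auto simp: vanishes_on_def)
  next
    case (Suc n)
    then obtain Z where Z: "vanishes_on f Z" "size Z = N * n" "\<forall>y\<in>#Z. \<bar>y\<bar> < real n * L"
      "(\<Sum>y\<in>#Z. \<bar>y\<bar>) \<le> N * L * (real n * (real n + 1) / 2)"
      by blast
    obtain Y where Y: "vanishes_on f Y" "size Y = N"
      "\<forall>y\<in>#Y. real n * L < \<bar>y\<bar> \<and> \<bar>y\<bar> < (real n + 1) * L"
      using zeros[of n] unfolding has_zeros_def by blast
    have "(\<Sum>y\<in>#Y. \<bar>y\<bar>) \<le> (\<Sum>y\<in>#Y. (real n + 1) * L)"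
      using Y(3) by (intro sum_mset_mono) (auto simp: less_imp_le)
    then have "(\<Sum>y\<in>#Z + Y. \<bar>y\<bar>) \<le> N * L * (real (Suc n) * (real (Suc n) + 1) / 2)"
      using Z(4) Y(2) by (simp add: field_simps)
    moreover have "vanishes_on f (Z + Y)"
      by (rule vanishes_on_add_disjoint[OF Z(1) Y(1)]) (use Z(3) Y(3) in fastforce)
    moreover have "\<forall>y\<in>#Z + Y. \<bar>y\<bar> < real (Suc n) * L"
      using Z(3) Y(3) \<open>L > 0\<close> by (auto simp: algebra_simps dest!: bspec)
    ultimately show ?case
      using Z(2) Y(2) by (intro exI[of _ "Z + Y"]) simp
  qed
  then show ?thesis
    using that by blast
qed

section \<open>Smooth functions and Rolle's theorem\<close>

definition smooth :: "(real \<Rightarrow> real) \<Rightarrow> bool" where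
  "smooth f \<longleftrightarrow> (\<forall>i x. ((deriv ^^ i) f has_real_derivative (deriv ^^ Suc i) f x) (at x))"

lemma higher_deriv_eqI:
  fixes u :: "nat \<Rightarrow> 'a::real_normed_field \<Rightarrow> 'a"
  assumes "\<And>i x. (u i has_field_derivative u (Suc i) x) (at x)"
  shows "(deriv ^^ i) (u 0) = u i"
  by (induction i) (use assms in \<open>auto intro!: DERIV_imp_deriv\<close>)

lemma higher_deriv_add_deriv:
  assumes "smooth f"
  shows "(deriv ^^ i) (\<lambda>x. f x + d * deriv f x) = (\<lambda>x. (deriv ^^ i) f x + d * (deriv ^^ Suc i) f x)"
proof -
  have "(deriv ^^ i) ((\<lambda>i x. (deriv ^^ i) f x + d * (deriv ^^ Suc i) f x) 0) =
      (\<lambda>i x. (deriv ^^ i) f x + d * (deriv ^^ Suc i) f x) i"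
    using assms unfolding smooth_def by (intro higher_deriv_eqI DERIV_add DERIV_cmult) blast+
  then show ?thesis by simp
qed

lemma Rolle_add_deriv:
  fixes f f' :: "real \<Rightarrow> real"
  assumes der: "\<And>x. (f has_real_derivative f' x) (at x)"
    and "d \<noteq> 0" "a < b" "f a = 0" "f b = 0"
  obtains x where "a < x" "x < b" "f x + d * f' x = 0"
proof -
  let ?F = "\<lambda>x. exp (x / d) * f x"
  have der_F: "(?F has_real_derivative exp (x / d) * (f x + d * f' x) / d) (at x)" for x
    by (rule derivative_eq_intros der refl | use \<open>d \<noteq> 0\<close> in \<open>simp add: field_simps\<close>)+
  have "\<exists>x. a < x \<and> x < b \<and> (?F has_real_derivative 0) (at x)"
  proof (rule Rolle)
    show "continuous_on {a..b} ?F"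
      by (intro DERIV_continuous_on) (rule DERIV_subset[OF der_F], simp)
    show "?F differentiable at x" for x
      using der_F real_differentiable_def by blast
  qed (use assms in auto)
  then obtain x where x: "a < x" "x < b" "(?F has_real_derivative 0) (at x)"
    by blast
  then have "exp (x / d) * (f x + d * f' x) / d = 0"
    using der_F DERIV_unique by blast
  then show ?thesis
    using that x(1,2) \<open>d \<noteq> 0\<close> by simp
qed

lemma interlacing_zeros_add_deriv:
  fixes f f' :: "real \<Rightarrow> real"
  assumes der: "\<And>x. (f has_real_derivative f' x) (at x)" and "d \<noteq> 0"
    and "finite S" "\<And>y. y \<in> S \<Longrightarrow> f y = 0" "S \<subseteq> {a..b}"
  obtains T where "finite T" "card T = card S - 1" "S \<inter> T = {}" "T \<subseteq> {a..b}"
    "\<And>x. x \<in> T \<Longrightarrow> f x + d * f' x = 0"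
proof -
  have "\<exists>T. finite T \<and> card T = card S - 1 \<and> S \<inter> T = {} \<and> T \<subseteq> {a..b} \<and>
      (\<forall>x\<in>T. f x + d * f' x = 0) \<and> (\<forall>x\<in>T. \<exists>y\<in>S. x < y)"
    using assms(3-5)
  proof (induction S rule: finite_linorder_max_induct)
    case empty
    then show ?case by auto
  next
    case (insert z S)
    then obtain T where T: "finite T" "card T = card S - 1" "S \<inter> T = {}" "T \<subseteq> {a..b}"
      "\<forall>x\<in>T. f x + d * f' x = 0" "\<forall>x\<in>T. \<exists>y\<in>S. x < y"
      by auto
    show ?case
    proof (cases "S = {}")
      case True
      then show ?thesis by (intro exI[of _ "{}"]) auto
    next
      case False
      with insert.hyps have max: "Max S \<in> S" "Max S < z" "\<And>y. y \<in> S \<Longrightarrow> y \<le> Max S"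
        by auto
      with insert.prems have "f (Max S) = 0" "f z = 0" "a \<le> Max S" "z \<le> b"
        by auto
      then obtain x where x: "Max S < x" "x < z" "f x + d * f' x = 0"
        using Rolle_add_deriv[OF der \<open>d \<noteq> 0\<close> max(2)] by blast
      have below: "y < x" if "y \<in> S \<union> T" for y
        using that T(6) max(3) x(1) by fastforce
      then have "x \<notin> T" "z \<notin> S" "card S > 0"
        using insert.hyps False by (auto simp: card_gt_0_iff)
      then have "card (insert x T) = card (insert z S) - 1"
        using T(1,2) insert.hyps(1) by simp
      moreover have "insert z S \<inter> insert x T = {}"
        using T(3) below x(2) by force
      moreover have "\<forall>t\<in>insert x T. \<exists>y\<in>insert z S. t < y"
        using T(6) x(2) by blast
      ultimately show ?thesis
        using T(1,4,5) x \<open>a \<le> Max S\<close> \<open>z \<le> b\<close> by (intro exI[of _ "insert x T"]) auto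
    qed
  qed
  then show ?thesis
    using that by blast
qed

lemma vanishes_on_add_deriv:
  assumes f: "smooth f" and Z: "vanishes_on f Z"
  shows "vanishes_on (\<lambda>x. f x + d * deriv f x) (Z - mset_set (set_mset Z))"
  unfolding vanishes_on_def higher_deriv_add_deriv[OF f]
proof (intro allI impI)
  fix y i assume "i < count (Z - mset_set (set_mset Z)) y"
  then have "Suc i < count Z y"
    by (cases "y \<in># Z") (auto simp: not_in_iff)
  then show "(deriv ^^ i) f y + d * (deriv ^^ Suc i) f y = 0"
    using Z unfolding vanishes_on_def by (simp del: funpow.simps)
qed

lemma has_zeros_add_deriv:
  assumes f: "smooth f" and zeros: "has_zeros f (Suc N) {a..b}"
  shows "has_zeros (\<lambda>x. f x + d * deriv f x) N {a..b}"
proof (cases "d = 0")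
  case True
  then show ?thesis
    using has_zeros_mono[OF zeros] by simp
next
  case False
  obtain Z where Z: "vanishes_on f Z" "size Z = Suc N" "set_mset Z \<subseteq> {a..b}"
    using zeros unfolding has_zeros_def by blast
  have "(f has_real_derivative deriv f x) (at x)" for x
    using f unfolding smooth_def by (metis funpow_0 funpow_simps_right(1) funpow.simps o_apply)
  moreover have "f y = 0" if "y \<in># Z" for y
    using Z(1) that unfolding vanishes_on_def by (metis count_greater_zero_iff funpow_0)
  ultimately obtain T where T: "finite T" "card T = card (set_mset Z) - 1" "set_mset Z \<inter> T = {}"
      "T \<subseteq> {a..b}" "\<And>x. x \<in> T \<Longrightarrow> f x + d * deriv f x = 0"
    using interlacing_zeros_add_deriv[OF _ False finite_set_mset _ Z(3)] by metis
  \<comment> \<open>Every multiplicity drops by one, and the gaps between zeros contribute new simple zeros.\<close>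
  let ?Y = "Z - mset_set (set_mset Z)"
  have sub: "mset_set (set_mset Z) \<subseteq># Z"
    by (rule mset_set_set_mset_msubset)
  show ?thesis
    unfolding has_zeros_def
  proof (intro exI[of _ "?Y + mset_set T"] conjI)
    show "vanishes_on (\<lambda>x. f x + d * deriv f x) (?Y + mset_set T)"
      using T(1,3,5) vanishes_on_add_deriv[OF f Z(1)]
      by (intro vanishes_on_add_disjoint vanishes_on_mset_set) (auto dest: in_diffD)
    have "card (set_mset Z) > 0"
      using Z(2) by (auto simp: card_gt_0_iff)
    then show "size (?Y + mset_set T) = N"
      using T(2) Z(2) size_mset_mono[OF sub] by (simp add: size_Diff_submset[OF sub])
    show "set_mset (?Y + mset_set T) \<subseteq> {a..b}"
      using T(1,4) Z(3) by (auto dest: in_diffD)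
  qed
qed

section \<open>Zeros of entire functions that are periodic along the imaginary axis\<close>

lemma holomorphic_bigo_power:
  assumes f: "f holomorphic_on A" "open A" "z \<in> A" and zero: "\<And>i. i < m \<Longrightarrow> (deriv ^^ i) f z = 0"
  shows "f \<in> O[at z](\<lambda>w. (w - z) ^ m)"
proof (cases m)
  case 0
  have "isCont f z"
    using f continuous_on_eq_continuous_at holomorphic_on_imp_continuous_on by blast
  then show ?thesis
    unfolding 0 by (simp add: continuous_imp_bigo_1)
next
  case (Suc n)
  obtain r where r: "r > 0" "cball z r \<subseteq> A"
    using f(2,3) open_contains_cball by blast
  have hol: "(deriv ^^ i) f holomorphic_on A" for i
    by (rule holomorphic_higher_deriv[OF f(1,2)])
  have "bounded ((deriv ^^ Suc n) f ` cball z r)"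
    by (intro compact_imp_bounded compact_continuous_image compact_cball
        holomorphic_on_imp_continuous_on holomorphic_on_subset[OF hol r(2)])
  then obtain B where B: "\<And>w. w \<in> cball z r \<Longrightarrow> norm ((deriv ^^ Suc n) f w) \<le> B"
    unfolding bounded_iff by blast
  have "\<forall>\<^sub>F w in at z. w \<in> ball z r"
    using r(1) by (intro eventually_at_in_open') auto
  then have "\<forall>\<^sub>F w in at z. norm (f w) \<le> B / fact n * norm ((w - z) ^ Suc n)"
  proof eventually_elim
    case (elim w)
    have "norm ((deriv ^^ 0) f w - (\<Sum>i\<le>n. (deriv ^^ i) f z * (w - z) ^ i / fact i)) \<le>
        B * norm (w - z) ^ Suc n / fact n"
    proof (rule field_Taylor[OF convex_cball[of z r]])
      show "((deriv ^^ i) f has_field_derivative (deriv ^^ Suc i) f x) (at x within cball z r)"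
        if "x \<in> cball z r" for i x
        using holomorphic_derivI[OF hol f(2), of x i] r(2) that by auto
      show "norm ((deriv ^^ Suc n) f x) \<le> B" if "x \<in> cball z r" for x
        by (rule B[OF that])
    qed (use elim r(1) in \<open>auto simp: less_imp_le\<close>)
    moreover have "(\<Sum>i\<le>n. (deriv ^^ i) f z * (w - z) ^ i / fact i) = 0"
      using zero by (intro sum.neutral) (auto simp: Suc)
    ultimately show "norm (f w) \<le> B / fact n * norm ((w - z) ^ Suc n)"
      by (simp add: norm_mult norm_power)
  qed
  then show ?thesis
    unfolding Suc by (rule bigoI)
qed

lemma tendsto_quotient_if_bigo:
  assumes f: "f holomorphic_on ball z r" and g: "g holomorphic_on ball z r" and "r > 0"
    and nonzero: "\<And>w. w \<in> ball z r - {z} \<Longrightarrow> g w \<noteq> 0" and bigo: "f \<in> O[at z](g)"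
  obtains l where "(\<lambda>w. f w / g w) \<midarrow>z\<rightarrow> l"
proof -
  let ?h = "\<lambda>w. f w / g w"
  obtain c where "\<forall>\<^sub>F w in at z. norm (f w) \<le> c * norm (g w)"
    using landau_o.bigE[OF bigo] .
  moreover have "\<forall>\<^sub>F w in at z. g w \<noteq> 0"
    using eventually_at_in_open[OF open_ball, of z z r] \<open>r > 0\<close> nonzero by (auto elim!: eventually_mono)
  ultimately have "\<forall>\<^sub>F w in at z. norm (?h w) \<le> c * norm (1::complex)"
    by eventually_elim (simp add: norm_divide field_simps)
  then have "?h \<in> O[at z](\<lambda>_. 1)"
    by (rule bigoI)
  moreover have "?h holomorphic_on ball z r - {z}"
    using f g nonzero by (intro holomorphic_on_divide) (auto intro: holomorphic_on_subset)
  ultimately obtain k where k: "k holomorphic_on ball z r" "\<And>w. w \<in> ball z r - {z} \<Longrightarrow> k w = ?h w"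
    using holomorphic_on_extend[of ?h "ball z r" z] \<open>r > 0\<close> by auto
  have "k \<midarrow>z\<rightarrow> k z"
    using k(1) \<open>r > 0\<close> continuous_on_eq_continuous_at[of "ball z r" k] holomorphic_on_imp_continuous_on
    by (auto simp: isCont_def)
  then have "?h \<midarrow>z\<rightarrow> k z"
    by (rule Lim_transform_within_open[OF _ open_ball]) (use k(2) \<open>r > 0\<close> in \<open>auto simp: dist_commute\<close>)
  then show ?thesis
    by (rule that)
qed

lemma holomorphic_divide_bigo:
  assumes A: "open A" "connected A" and f: "f holomorphic_on A" and g: "g holomorphic_on A"
    and nonzero: "\<beta> \<in> A" "g \<beta> \<noteq> 0"
    and bigo: "\<And>z. z \<in> A \<Longrightarrow> g z = 0 \<Longrightarrow> f \<in> O[at z](g)"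
  obtains q where "q holomorphic_on A" "\<And>z. z \<in> A \<Longrightarrow> f z = g z * q z"
proof -
  let ?h = "\<lambda>z. f z / g z"
  have local: "remove_sings ?h analytic_on {z} \<and> f z = g z * remove_sings ?h z" if z: "z \<in> A" for z
  proof (cases "g z = 0")
    case False
    then have "?h analytic_on {z}"
      using f g A(1) z by (intro analytic_on_divide) (auto simp: analytic_on_open analytic_at)
    then show ?thesis
      using False remove_sings_analytic_on by simp
  next
    case True
    obtain r where r: "r > 0" "ball z r \<subseteq> A" "\<And>w. w \<in> ball z r - {z} \<Longrightarrow> g w \<noteq> 0"
      using isolated_zeros[OF g A z True nonzero] by blast
    have hol: "f holomorphic_on ball z r" "g holomorphic_on ball z r"
      using f g r(2) holomorphic_on_subset by blast+
    obtain l where l: "?h \<midarrow>z\<rightarrow> l"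
      using tendsto_quotient_if_bigo[OF hol r(1,3) bigo[OF z True]] by blast
    have lims: "f \<midarrow>z\<rightarrow> f z" "g \<midarrow>z\<rightarrow> 0"
      using f g A(1) z True holomorphic_on_imp_continuous_on continuous_on_eq_continuous_at isContD
      by metis+
    have "\<forall>\<^sub>F w in at z. ?h w * g w = f w"
      using non_zero_neighbour_alt[OF g A z nonzero] by eventually_elim simp
    moreover have "(\<lambda>w. ?h w * g w) \<midarrow>z\<rightarrow> l * 0"
      by (intro tendsto_mult l lims)
    ultimately have "f \<midarrow>z\<rightarrow> 0"
      by (simp add: tendsto_cong)
    with lims(1) have "f z = 0"
      using LIM_unique by blast
    moreover have "?h holomorphic_on ball z r - {z}"
      using hol r(3) by (intro holomorphic_on_divide) (auto intro: holomorphic_on_subset)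
    then have "isolated_singularity_at ?h z"
      by (rule isolated_singularity_at_holomorphic) (use r(1) in auto)
    ultimately show ?thesis
      using remove_sings_analytic_at[OF _ l] True by simp
  qed
  show ?thesis
  proof (rule that)
    show "remove_sings ?h holomorphic_on A"
      using local by (intro analytic_imp_holomorphic) (subst analytic_on_analytic_at, blast)
  qed (use local in blast)
qed

lemma norm_periodic_attains_max_on_strip:
  fixes G :: "complex \<Rightarrow> complex"
  assumes cont: "continuous_on UNIV G" and "\<tau> > 0" "s \<ge> 0"
    and periodic: "\<And>z. norm (G (z + \<i> * of_real \<tau>)) = norm (G z)"
  obtains \<zeta> where "\<bar>Re \<zeta>\<bar> \<le> s" "\<And>w. \<bar>Re w\<bar> \<le> s \<Longrightarrow> norm (G w) \<le> norm (G \<zeta>)"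
proof -
  interpret periodic_fun_simple "\<lambda>z. norm (G z)" "\<i> * of_real \<tau>"
    by standard (rule periodic)
  define Q where "Q = cbox (Complex (- s) 0) (Complex s \<tau>)"
  have "0 \<in> Q"
    using assms(2,3) by (auto simp: Q_def in_cbox_complex_iff)
  then obtain \<zeta> where \<zeta>: "\<zeta> \<in> Q" "\<And>w. w \<in> Q \<Longrightarrow> norm (G w) \<le> norm (G \<zeta>)"
    using continuous_attains_sup[of Q "\<lambda>w. norm (G w)"] cont
    by (auto simp: Q_def intro: continuous_on_norm continuous_on_subset)
  have "norm (G w) \<le> norm (G \<zeta>)" if "\<bar>Re w\<bar> \<le> s" for w
  proof -
    define k where "k = - \<lfloor>Im w / \<tau>\<rfloor>"
    have "Im (w + of_int k * (\<i> * of_real \<tau>)) = frac (Im w / \<tau>) * \<tau>"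
      using \<open>\<tau> > 0\<close> by (simp add: k_def frac_def field_simps)
    moreover have "0 \<le> frac (Im w / \<tau>) * \<tau>" "frac (Im w / \<tau>) * \<tau> \<le> 1 * \<tau>"
      using \<open>\<tau> > 0\<close> frac_lt_1[of "Im w / \<tau>"] by (auto intro!: mult_right_mono)
    ultimately have "w + of_int k * (\<i> * of_real \<tau>) \<in> Q"
      using that by (auto simp: Q_def in_cbox_complex_iff)
    then show ?thesis
      using \<zeta>(2) plus_of_int[of w k] by metis
  qed
  moreover have "\<bar>Re \<zeta>\<bar> \<le> s"
    using \<zeta>(1) by (auto simp: Q_def in_cbox_complex_iff)
  ultimately show ?thesis
    using that by blast
qed

lemma maximum_modulus_periodic_strip:
  fixes G :: "complex \<Rightarrow> complex"
  assumes hol: "G holomorphic_on UNIV" and "\<tau> > 0"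
    and periodic: "\<And>z. norm (G (z + \<i> * of_real \<tau>)) = norm (G z)"
    and boundary: "\<And>z. \<bar>Re z\<bar> = s \<Longrightarrow> norm (G z) \<le> B" and z: "\<bar>Re z\<bar> \<le> s"
  shows "norm (G z) \<le> B"
proof -
  have cont: "continuous_on UNIV G"
    using hol by (rule holomorphic_on_imp_continuous_on)
  have "s \<ge> 0"
    using z by linarith
  then obtain \<zeta> where \<zeta>: "\<bar>Re \<zeta>\<bar> \<le> s" and max: "\<And>w. \<bar>Re w\<bar> \<le> s \<Longrightarrow> norm (G w) \<le> norm (G \<zeta>)"
    using norm_periodic_attains_max_on_strip[OF cont \<open>\<tau> > 0\<close> _ periodic] by blast
  have "norm (G \<zeta>) \<le> B"
  proof (cases "\<bar>Re \<zeta>\<bar> = s")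
    case True
    then show ?thesis by (rule boundary)
  next
    case False
    define S where "S = {w. - s < Re w} \<inter> {w. Re w < s}"
    have S: "open S" "convex S" "\<zeta> \<in> S"
      using False \<zeta> by (auto simp: S_def intro!: open_Int open_halfspace_Re_gt open_halfspace_Re_lt
          convex_Int convex_halfspace_Re_gt convex_halfspace_Re_lt)
    then have "G constant_on S"
      by (intro maximum_modulus_principle[OF _ S(1) convex_connected[OF S(2)] S(1) order_refl S(3)])
         (auto simp: S_def intro!: max holomorphic_on_subset[OF hol])
    then have const: "G w = G \<zeta>" if "w \<in> S" for w
      using S(3) that by (auto simp: constant_on_def)
    have "s > 0"
      using S(3) by (auto simp: S_def)
    have "((\<lambda>t. G (of_real t)) \<longlongrightarrow> G (of_real s)) (at_left s)"
      using cont by (intro isCont_tendsto_compose[of _ G] tendsto_intros)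
        (auto simp: continuous_on_eq_continuous_at)
    moreover have "\<forall>\<^sub>F t in at_left s. G (of_real t) = G \<zeta>"
      using eventually_at_left_real[of "- s" s] \<open>s > 0\<close>
      by (auto elim!: eventually_mono intro!: const simp: S_def)
    ultimately have "G (of_real s) = G \<zeta>"
      by (metis tendsto_eventually tendsto_unique trivial_limit_at_left_real)
    then show ?thesis
      using boundary[of "of_real s"] \<open>s > 0\<close> by simp
  qed
  then show ?thesis
    using max[OF z] by linarith
qed

lemma bigo_norm_periodic:
  fixes f g :: "complex \<Rightarrow> complex"
  assumes "f \<in> O[at z](g)"
    and "\<And>w. norm (f (w + p)) = norm (f w)" "\<And>w. norm (g (w + p)) = norm (g w)"
  shows "f \<in> O[at (z + of_int k * p)](g)"
proof -
  interpret f: periodic_fun_simple "\<lambda>w. norm (f w)" p by standard (rule assms(2))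
  interpret g: periodic_fun_simple "\<lambda>w. norm (g w)" p by standard (rule assms(3))
  obtain c where "\<forall>\<^sub>F w in at z. norm (f w) \<le> c * norm (g w)"
    using landau_o.bigE[OF assms(1)] .
  then have "\<forall>\<^sub>F w in at z. norm (f (w + of_int k * p)) \<le> c * norm (g (w + of_int k * p))"
    by (simp add: f.plus_of_int g.plus_of_int)
  moreover have "at (z + of_int k * p) = filtermap (\<lambda>w. w + of_int k * p) (at z)"
    using filtermap_at_shift[of "- (of_int k * p)" z] by simp
  ultimately show ?thesis
    by (intro bigoI[of _ c]) (simp add: eventually_filtermap)
qed

lemma norm_periodic_factor:
  fixes f g :: "complex \<Rightarrow> complex"
  assumes f: "f holomorphic_on UNIV" and g: "g holomorphic_on UNIV" and "f \<beta> \<noteq> 0"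
    and f_periodic: "\<And>w. norm (f (w + p)) = norm (f w)"
    and fg_periodic: "\<And>w. norm (f (w + p) * g (w + p)) = norm (f w * g w)"
  shows "norm (g (z + p)) = norm (g z)"
proof -
  have "\<forall>\<^sub>F w in at z. f w \<noteq> 0"
    using non_zero_neighbour_alt[OF f open_UNIV connected_UNIV UNIV_I UNIV_I \<open>f \<beta> \<noteq> 0\<close>]
    by (rule eventually_mono) simp
  then have "\<forall>\<^sub>F w in at z. norm (g (w + p)) = norm (g w)"
  proof eventually_elim
    case (elim w)
    then show ?case
      using f_periodic[of w] fg_periodic[of w] by (simp add: norm_mult)
  qed
  moreover have "isCont g w" for w
    using g continuous_on_eq_continuous_at holomorphic_on_imp_continuous_on by blast
  then have lims: "(\<lambda>w. norm (g (w + p))) \<midarrow>z\<rightarrow> norm (g (z + p))" "(\<lambda>w. norm (g w)) \<midarrow>z\<rightarrow> norm (g z)"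
    by (intro tendsto_norm isCont_tendsto_compose[of _ g] tendsto_add tendsto_ident_at tendsto_const;
        assumption)+
  ultimately have "(\<lambda>w. norm (g w)) \<midarrow>z\<rightarrow> norm (g (z + p))"
    by (auto intro: Lim_transform_eventually)
  then show ?thesis
    using lims(2) by (rule LIM_unique)
qed

lemma norm_sinh_le: "norm (sinh (z :: complex)) \<le> exp \<bar>Re z\<bar>"
proof -
  have "norm (sinh z) \<le> (norm (exp z) + norm (exp (- z))) / 2"
    using norm_triangle_ineq4[of "exp z" "exp (- z)"] by (simp add: sinh_field_def norm_divide)
  also have "\<dots> \<le> exp \<bar>Re z\<bar>"
    by (simp add: abs_if)
  finally show ?thesis .
qed

lemma norm_sinh_ge: "sinh \<bar>Re z\<bar> \<le> norm (sinh (z :: complex))"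
proof -
  have "\<bar>norm (exp z) - norm (exp (- z))\<bar> / 2 \<le> norm (sinh z)"
    using norm_triangle_ineq3[of "exp z" "exp (- z)"] by (simp add: sinh_field_def norm_divide)
  then show ?thesis
    by (simp add: sinh_field_def abs_if split: if_splits)
qed

text \<open>The substitute for a Blaschke factor in the strip \<^prop>\<open>\<bar>Re z\<bar> \<le> s\<close>: a zero in each point of
  \<open>y + \<i> (\<pi> / a) \<int>\<close>, and by the choice of the exponential nearly constant modulus on the boundary.\<close>

definition strip_factor :: "real \<Rightarrow> real \<Rightarrow> real \<Rightarrow> complex \<Rightarrow> complex" where
  "strip_factor a s y z = sinh (of_real a * (z - of_real y)) * exp (of_real (a * y / s) * z)"

text \<open>How far \<^term>\<open>ln (norm (strip_factor a s y z))\<close> can fall below \<^term>\<open>a * s\<close> on the boundary, for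
  zeros \<^term>\<open>y\<close> at distance at least 1 from it.\<close>

definition strip_loss :: "real \<Rightarrow> real" where
  "strip_loss a = - ln ((1 - exp (- 2 * a)) / 2)"

lemma holomorphic_on_strip_factor [holomorphic_intros]:
  "f holomorphic_on A \<Longrightarrow> (\<lambda>z. strip_factor a s y (f z)) holomorphic_on A"
  unfolding strip_factor_def sinh_field_def by (intro holomorphic_intros) auto

lemma norm_strip_factor_periodic:
  assumes "a > 0"
  shows "norm (strip_factor a s y (z + \<i> * of_real (pi / a))) = norm (strip_factor a s y z)"
proof -
  let ?w = "\<lambda>z. of_real a * (z - of_real y)"
  have "?w (z + \<i> * of_real (pi / a)) = ?w z + of_real pi * \<i>"
    using assms by (simp add: field_simps)
  moreover have "sinh (w + of_real pi * \<i>) = - sinh w" for w :: complex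
    by (simp add: sinh_field_def exp_add exp_diff exp_minus field_simps)
  ultimately have "sinh (?w (z + \<i> * of_real (pi / a))) = - sinh (?w z)"
    by metis
  then show ?thesis
    by (simp add: strip_factor_def norm_mult)
qed

lemma strip_factor_eq_0D:
  assumes "a > 0" "strip_factor a s y z = 0"
  obtains k :: int where "z = of_real y + of_int k * (\<i> * of_real (pi / a))"
proof -
  let ?w = "of_real a * (z - of_real y)"
  have "exp ?w = exp (- ?w)"
    using assms(2) by (simp add: strip_factor_def sinh_field_def)
  then have "exp (2 * ?w) = 1"
    by (metis exp_minus_inverse mult_2 exp_add)
  then obtain k :: int where "a * (Re z - y) = 0" "2 * (a * Im z) = of_int (2 * k) * pi"
    by (auto simp: exp_eq_1)
  then show ?thesis
    using assms(1) by (intro that[of k]) (auto simp: complex_eq_iff field_simps)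
qed

lemma norm_strip_factor_le:
  assumes "a > 0" "\<bar>y\<bar> \<le> s"
  shows "norm (strip_factor a s y z) \<le> exp (a * (2 * \<bar>Re z\<bar> + \<bar>y\<bar>))"
proof -
  have "y / s * Re z \<le> \<bar>y / s\<bar> * \<bar>Re z\<bar>"
    by (metis abs_ge_self abs_mult)
  also have "\<dots> \<le> 1 * \<bar>Re z\<bar>"
    using assms(2) by (intro mult_right_mono) (auto simp: divide_le_eq_1)
  finally have le: "\<bar>Re z - y\<bar> + y / s * Re z \<le> 2 * \<bar>Re z\<bar> + \<bar>y\<bar>"
    by linarith
  have "norm (strip_factor a s y z) = norm (sinh (of_real a * (z - of_real y))) * exp (a * y / s * Re z)"
    by (simp add: strip_factor_def norm_mult)
  also have "\<dots> \<le> exp (a * \<bar>Re z - y\<bar>) * exp (a * y / s * Re z)"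
    using norm_sinh_le[of "of_real a * (z - of_real y)"] assms(1)
    by (intro mult_right_mono) (simp_all add: abs_mult)
  also have "\<dots> = exp (a * (\<bar>Re z - y\<bar> + y / s * Re z))"
    by (simp add: algebra_simps flip: exp_add)
  also have "\<dots> \<le> exp (a * (2 * \<bar>Re z\<bar> + \<bar>y\<bar>))"
    unfolding exp_le_cancel_iff using le assms(1) by (intro mult_left_mono) auto
  finally show ?thesis .
qed

lemma norm_strip_factor_boundary:
  assumes "a > 0" "\<bar>y\<bar> \<le> s - 1" "\<bar>Re z\<bar> = s"
  shows "exp (a * s - strip_loss a) \<le> norm (strip_factor a s y z)"
proof -
  define q where "q = (1 - exp (- 2 * a)) / 2"
  define t where "t = a * \<bar>Re z - y\<bar>"
  have "q > 0"
    using assms(1) by (simp add: q_def)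
  have "s \<ge> 1" "\<bar>Re z - y\<bar> \<ge> 1" "\<bar>Re z - y\<bar> + y / s * Re z = s"
    using assms(2,3) by (auto simp: abs_if split: if_splits)
  moreover have "t + a * y / s * Re z = a * (\<bar>Re z - y\<bar> + y / s * Re z)"
    by (simp add: t_def algebra_simps)
  ultimately have "t \<ge> a" and t: "t + a * y / s * Re z = a * s"
    using assms(1) by (simp_all add: t_def)
  have "strip_loss a = - ln q"
    by (simp add: strip_loss_def q_def)
  then have "exp (a * s - strip_loss a) = q * exp t * exp (a * y / s * Re z)"
    using \<open>q > 0\<close> by (simp add: exp_add flip: t)
  also have "q * exp t \<le> sinh t"
    using \<open>t \<ge> a\<close> by (simp add: q_def sinh_field_def field_simps flip: exp_add)
  also have "\<dots> \<le> norm (sinh (of_real a * (z - of_real y)))"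
    using norm_sinh_ge[of "of_real a * (z - of_real y)"] assms(1) by (simp add: t_def abs_mult)
  finally show ?thesis
    by (simp add: q_def strip_factor_def norm_mult)
qed

lemma linear_bigo_strip_factor:
  assumes "a > 0"
  shows "(\<lambda>z. z - of_real y) \<in> O[at (of_real y)](strip_factor a s y)"
proof -
  let ?D = "of_real a * exp (of_real (a * y / s) * of_real y)"
  have "((\<lambda>z. sinh (of_real a * (z - of_real y)) * exp (c * z)) has_field_derivative
      of_real a * exp (c * of_real y)) (at (of_real y))" for c :: complex
    by (auto intro!: derivative_eq_intros)
  then have "(strip_factor a s y has_field_derivative ?D) (at (of_real y))"
    unfolding strip_factor_def[abs_def] .
  then have "((\<lambda>z. strip_factor a s y z / (z - of_real y)) \<longlongrightarrow> ?D) (at (of_real y))"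
    by (simp add: has_field_derivative_iff strip_factor_def)
  then have "strip_factor a s y \<in> \<Omega>[at (of_real y)](\<lambda>z. z - of_real y)"
    by (intro bigomegaI_tendsto_norm[OF _ tendsto_norm]) (use assms in auto)
  then show ?thesis
    by (simp add: bigomega_iff_bigo)
qed

lemma holomorphic_on_prod_mset [holomorphic_intros]:
  "(\<And>y. y \<in># Z \<Longrightarrow> f y holomorphic_on A) \<Longrightarrow> (\<lambda>z. \<Prod>y\<in>#Z. f y z) holomorphic_on A"
  by (induction Z) (auto intro!: holomorphic_intros)

lemma exp_sum_le_norm_prod_mset:
  fixes f :: "'a \<Rightarrow> 'b::real_normed_field"
  assumes "\<And>y. y \<in># Z \<Longrightarrow> exp (g y) \<le> norm (f y)"
  shows "exp (\<Sum>y\<in>#Z. g y :: real) \<le> norm (\<Prod>y\<in>#Z. f y)"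
  using assms by (induction Z) (auto simp: exp_add norm_mult intro!: mult_mono)

lemma norm_prod_mset_le_exp_sum:
  fixes f :: "'a \<Rightarrow> 'b::real_normed_field"
  assumes "\<And>y. y \<in># Z \<Longrightarrow> norm (f y) \<le> exp (g y)"
  shows "norm (\<Prod>y\<in>#Z. f y) \<le> exp (\<Sum>y\<in>#Z. g y :: real)"
  using assms by (induction Z) (auto simp: exp_add norm_mult intro!: mult_mono)

lemma strip_factor_of_real_eq_0_iff:
  assumes "a > 0"
  shows "strip_factor a s y (of_real x) = 0 \<longleftrightarrow> x = y"
proof
  assume "strip_factor a s y (of_real x) = 0"
  then obtain k where "of_real x = of_real y + of_int k * (\<i> * of_real (pi / a))"
    using strip_factor_eq_0D[OF assms] by blast
  then have "Re (of_real x) = Re (of_real y + of_int k * (\<i> * of_real (pi / a)))"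
    by (rule arg_cong)
  then show "x = y"
    by simp
qed (simp add: strip_factor_def)

lemma bigo_prod_strip_factor:
  assumes "a > 0"
    and f: "f \<in> O[at (of_real y)](\<lambda>z. (z - of_real y) ^ count Z y)"
  shows "f \<in> O[at (of_real y)](\<lambda>z. \<Prod>x\<in>#Z. strip_factor a s x z)"
proof -
  let ?rest = "\<lambda>z. \<Prod>x\<in>#filter_mset (\<lambda>x. x \<noteq> y) Z. strip_factor a s x z"
  have split: "(\<Prod>x\<in>#Z. strip_factor a s x z) = strip_factor a s y z ^ count Z y * ?rest z" for z
  proof -
    have "Z = filter_mset (\<lambda>x. x \<noteq> y) Z + replicate_mset (count Z y) y"
      by (metis add.commute filter_eq_replicate_mset multiset_partition)
    then show ?thesis
      by (metis (no_types, lifting) image_mset_union image_replicate_mset mult.commute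
          prod_mset_Un prod_mset_replicate_mset)
  qed
  have "?rest (of_real y) \<noteq> 0"
    by (auto simp: prod_mset_zero_iff strip_factor_of_real_eq_0_iff[OF \<open>a > 0\<close>])
  moreover have "?rest holomorphic_on UNIV"
    by (intro holomorphic_intros)
  then have "?rest \<midarrow>of_real y\<rightarrow> ?rest (of_real y)"
    using continuous_on_eq_continuous_at holomorphic_on_imp_continuous_on isContD by blast
  ultimately have "?rest \<in> \<Omega>[at (of_real y)](\<lambda>_. 1)"
    by (intro bigomegaI_tendsto_norm[OF _ tendsto_norm]) auto
  then have "(\<lambda>_. 1) \<in> O[at (of_real y)](?rest)"
    by (simp add: bigomega_iff_bigo)
  moreover have "f \<in> O[at (of_real y)](\<lambda>z. strip_factor a s y z ^ count Z y)"
    using f landau_o.big_trans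
      landau_o.big_power[OF linear_bigo_strip_factor[OF \<open>a > 0\<close>, of y s], of "count Z y"] by blast
  ultimately show ?thesis
    unfolding split by (rule landau_o.big_mult_1[rotated])
qed

lemma factor_out_strip_factors:
  fixes F :: "complex \<Rightarrow> complex" and Z :: "real multiset"
  assumes "a > 0" and F: "F holomorphic_on UNIV"
    and periodic: "\<And>z. norm (F (z + \<i> * of_real (pi / a))) = norm (F z)"
    and zeros: "\<And>y. y \<in># Z \<Longrightarrow> F \<in> O[at (of_real y)](\<lambda>z. (z - of_real y) ^ count Z y)"
  obtains G where "G holomorphic_on UNIV" "\<And>z. F z = (\<Prod>y\<in>#Z. strip_factor a s y z) * G z"
    "\<And>z. norm (G (z + \<i> * of_real (pi / a))) = norm (G z)"
proof -
  define p where "p = \<i> * of_real (pi / a)"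
  let ?S = "\<lambda>z. \<Prod>y\<in>#Z. strip_factor a s y z"
  have F_periodic: "norm (F (z + p)) = norm (F z)" for z
    unfolding p_def by (rule periodic)
  have S: "?S holomorphic_on UNIV"
    by (intro holomorphic_intros)
  have S_periodic: "norm (?S (z + p)) = norm (?S z)" for z
    by (induction Z) (simp_all only: p_def norm_mult norm_strip_factor_periodic[OF \<open>a > 0\<close>]
        image_mset_empty image_mset_add_mset prod_mset.empty prod_mset.add_mset)
  obtain x where "x \<notin># Z"
    using ex_new_if_finite[OF infinite_UNIV_char_0 finite_set_mset] by blast
  then have S_nonzero: "?S (of_real x) \<noteq> 0"
    by (auto simp: prod_mset_zero_iff strip_factor_of_real_eq_0_iff[OF \<open>a > 0\<close>])
  have "F \<in> O[at z](?S)" if zero: "?S z = 0" for z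
  proof -
    obtain y where y: "y \<in># Z" "strip_factor a s y z = 0"
      using zero by (auto simp: prod_mset_zero_iff)
    then obtain k where k: "z = of_real y + of_int k * p"
      unfolding p_def by (elim strip_factor_eq_0D[OF \<open>a > 0\<close>])
    show ?thesis
      unfolding k by (intro bigo_norm_periodic bigo_prod_strip_factor zeros \<open>a > 0\<close> y(1)
          S_periodic F_periodic)
  qed
  then obtain G where G: "G holomorphic_on UNIV" "\<And>z. F z = ?S z * G z"
    using holomorphic_divide_bigo[OF open_UNIV connected_UNIV F S UNIV_I S_nonzero] by (metis UNIV_I)
  have "norm (?S (w + p) * G (w + p)) = norm (?S w * G w)" for w
    using F_periodic unfolding G(2) .
  then have "norm (G (z + p)) = norm (G z)" for z
    by (rule norm_periodic_factor[OF S G(1) S_nonzero S_periodic])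
  with G show ?thesis
    using that unfolding p_def by blast
qed

text \<open>A Jensen inequality for the strip: each zero \<^term>\<open>y\<close> gains the factor \<open>exp (- a (s - \<bar>y\<bar>))\<close>.\<close>

lemma norm_le_if_real_zeros_periodic_strip:
  fixes F :: "complex \<Rightarrow> complex" and Z :: "real multiset"
  assumes "a > 0" and F: "F holomorphic_on UNIV"
    and periodic: "\<And>z. norm (F (z + \<i> * of_real (pi / a))) = norm (F z)"
    and boundary: "\<And>z. \<bar>Re z\<bar> = s \<Longrightarrow> norm (F z) \<le> K"
    and Z: "\<And>y. y \<in># Z \<Longrightarrow> \<bar>y\<bar> \<le> s - 1"
    and zeros: "\<And>y. y \<in># Z \<Longrightarrow> F \<in> O[at (of_real y)](\<lambda>z. (z - of_real y) ^ count Z y)"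
    and z: "\<bar>Re z\<bar> \<le> s"
  shows "norm (F z) \<le> K * exp (\<Sum>y\<in>#Z. a * (2 * \<bar>Re z\<bar> + \<bar>y\<bar> - s) + strip_loss a)"
proof -
  define \<sigma> where "\<sigma> = (\<Sum>y\<in>#Z. a * s - strip_loss a)"
  let ?S = "\<lambda>z. \<Prod>y\<in>#Z. strip_factor a s y z"
  obtain G where G: "G holomorphic_on UNIV" "\<And>z. F z = ?S z * G z"
    "\<And>z. norm (G (z + \<i> * of_real (pi / a))) = norm (G z)"
    using factor_out_strip_factors[OF \<open>a > 0\<close> F periodic zeros] by blast
  have "norm (G z) \<le> K * exp (- \<sigma>)"
  proof (rule maximum_modulus_periodic_strip[OF G(1) _ G(3) _ z])
    fix z assume "\<bar>Re z\<bar> = s"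
    then have "exp \<sigma> \<le> norm (?S z)"
      unfolding \<sigma>_def using norm_strip_factor_boundary[OF \<open>a > 0\<close> Z]
      by (intro exp_sum_le_norm_prod_mset)
    then have "exp \<sigma> * norm (G z) \<le> norm (F z)"
      unfolding G(2) norm_mult by (intro mult_right_mono) auto
    also have "\<dots> \<le> K"
      using \<open>\<bar>Re z\<bar> = s\<close> by (rule boundary)
    finally show "norm (G z) \<le> K * exp (- \<sigma>)"
      by (simp add: exp_minus field_simps)
  qed (use \<open>a > 0\<close> in simp)
  moreover have "norm (?S z) \<le> exp (\<Sum>y\<in>#Z. a * (2 * \<bar>Re z\<bar> + \<bar>y\<bar>))"
    using Z by (intro norm_prod_mset_le_exp_sum norm_strip_factor_le \<open>a > 0\<close>) fastforce
  ultimately have "norm (F z) \<le> exp (\<Sum>y\<in>#Z. a * (2 * \<bar>Re z\<bar> + \<bar>y\<bar>)) * (K * exp (- \<sigma>))"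
    unfolding G(2) norm_mult by (intro mult_mono) auto
  also have "\<dots> = K * exp ((\<Sum>y\<in>#Z. a * (2 * \<bar>Re z\<bar> + \<bar>y\<bar>)) - \<sigma>)"
    by (simp add: exp_diff exp_minus divide_inverse)
  also have "(\<Sum>y\<in>#Z. a * (2 * \<bar>Re z\<bar> + \<bar>y\<bar>)) - \<sigma> =
      (\<Sum>y\<in>#Z. a * (2 * \<bar>Re z\<bar> + \<bar>y\<bar> - s) + strip_loss a)"
    unfolding \<sigma>_def by (induction Z) (simp_all add: algebra_simps)
  finally show ?thesis .
qed

lemma norm_le_if_real_zeros_gauss_growth:
  fixes F :: "complex \<Rightarrow> complex" and Z :: "real multiset"
  assumes "a > 0" and F: "F holomorphic_on UNIV"
    and periodic: "\<And>z. norm (F (z + \<i> * of_real (pi / a))) = norm (F z)"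
    and growth: "\<And>z. norm (F z) \<le> C * exp (a * (Re z)\<^sup>2)"
    and Z: "\<And>y. y \<in># Z \<Longrightarrow> \<bar>y\<bar> \<le> t"
    and zeros: "\<And>y. y \<in># Z \<Longrightarrow> F \<in> O[at (of_real y)](\<lambda>z. (z - of_real y) ^ count Z y)"
    and x: "\<bar>x\<bar> \<le> t"
  shows "norm (F (of_real x)) \<le> C * exp (a * (t + 1)\<^sup>2 + a * (\<Sum>y\<in>#Z. \<bar>y\<bar>) +
    size Z * (a * (2 * \<bar>x\<bar> - (t + 1)) + strip_loss a))"
proof -
  have "norm (F (of_real x)) \<le> (C * exp (a * (t + 1)\<^sup>2)) *
      exp (\<Sum>y\<in>#Z. a * (2 * \<bar>Re (of_real x)\<bar> + \<bar>y\<bar> - (t + 1)) + strip_loss a)"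
  proof (rule norm_le_if_real_zeros_periodic_strip[OF assms(1,2) periodic _ _ zeros])
    show "norm (F z) \<le> C * exp (a * (t + 1)\<^sup>2)" if "\<bar>Re z\<bar> = t + 1" for z
      using growth[of z] that by (metis power2_abs)
  qed (use Z x in auto)
  also have "(\<Sum>y\<in>#Z. a * (2 * \<bar>Re (of_real x)\<bar> + \<bar>y\<bar> - (t + 1)) + strip_loss a) =
      a * (\<Sum>y\<in>#Z. \<bar>y\<bar>) + size Z * (a * (2 * \<bar>x\<bar> - (t + 1)) + strip_loss a)"
    by (induction Z) (simp_all add: algebra_simps)
  finally show ?thesis
    by (simp only: exp_add mult.assoc)
qed

lemma gauss_growth_eq_0_if_many_zeros:
  fixes F :: "complex \<Rightarrow> complex"
  assumes "a > 0" and F: "F holomorphic_on UNIV"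
    and periodic: "\<And>z. norm (F (z + \<i> * of_real (pi / a))) = norm (F z)"
    and "C \<ge> 0" and growth: "\<And>z. norm (F z) \<le> C * exp (a * (Re z)\<^sup>2)"
    and "L > 0" "real N > 2 * L"
    and zeros: "\<And>n. \<exists>Z. size Z = N * n \<and> (\<Sum>y\<in>#Z. \<bar>y\<bar>) \<le> N * L * (real n * (real n + 1) / 2) \<and>
      (\<forall>y\<in>#Z. \<bar>y\<bar> \<le> real n * L \<and> F \<in> O[at (of_real y)](\<lambda>z. (z - of_real y) ^ count Z y))"
  shows "F (of_real x) = 0"
proof -
  define \<alpha> where "\<alpha> = - (a * L * (N / 2 - L))"
  define \<beta> where "\<beta> = 2 * a * L + a * N * L / 2 + N * (a * (2 * \<bar>x\<bar> - 1) + strip_loss a)"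
  have decay: "norm (F (of_real x)) \<le> C * exp (\<alpha> * real n ^ 2 + \<beta> * real n + a)"
    if n: "\<bar>x\<bar> \<le> real n * L" for n
  proof -
    obtain Z where Z: "size Z = N * n" "(\<Sum>y\<in>#Z. \<bar>y\<bar>) \<le> N * L * (real n * (real n + 1) / 2)"
      "\<And>y. y \<in># Z \<Longrightarrow> \<bar>y\<bar> \<le> real n * L"
      "\<And>y. y \<in># Z \<Longrightarrow> F \<in> O[at (of_real y)](\<lambda>z. (z - of_real y) ^ count Z y)"
      using zeros[of n] by blast
    let ?gain = "size Z * (a * (2 * \<bar>x\<bar> - (real n * L + 1)) + strip_loss a)"
    have "norm (F (of_real x)) \<le> C * exp (a * (real n * L + 1)\<^sup>2 + a * (\<Sum>y\<in>#Z. \<bar>y\<bar>) + ?gain)"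
      by (rule norm_le_if_real_zeros_gauss_growth[OF assms(1) F periodic growth Z(3,4) n])
    also have "\<dots> \<le> C * exp (a * (real n * L + 1)\<^sup>2 + a * (N * L * (real n * (real n + 1) / 2)) + ?gain)"
      using \<open>C \<ge> 0\<close> Z(2) assms(1)
      by (intro mult_left_mono exp_le_cancel_iff[THEN iffD2] add_left_mono add_right_mono) auto
    also have "\<dots> = C * exp (\<alpha> * real n ^ 2 + \<beta> * real n + a)"
      by (simp add: Z(1) \<alpha>_def \<beta>_def power2_eq_square field_simps)
    finally show ?thesis .
  qed
  have "\<alpha> < 0"
    using assms(1,6,7) by (simp add: \<alpha>_def)
  then have "(\<lambda>n. C * exp (\<alpha> * real n ^ 2 + \<beta> * real n + a)) \<longlonglongrightarrow> 0"
    by real_asymp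
  moreover have "\<forall>\<^sub>F n in sequentially. \<bar>x\<bar> \<le> real n * L"
    using \<open>L > 0\<close> by real_asymp
  then have "\<forall>\<^sub>F n in sequentially. norm (F (of_real x)) \<le> C * exp (\<alpha> * real n ^ 2 + \<beta> * real n + a)"
    by (rule eventually_mono) (rule decay)
  ultimately have "norm (F (of_real x)) \<le> 0"
    by (rule tendsto_lowerbound) simp
  then show ?thesis
    by simp
qed

section \<open>Sums over integer translates\<close>

definition bounded_periodization :: "(real \<Rightarrow> real) \<Rightarrow> bool" where
  "bounded_periodization f \<longleftrightarrow> (\<forall>x. 0 \<le> f x) \<and>
     (\<exists>C. \<forall>x F. finite F \<longrightarrow> (\<Sum>k\<in>F. f (x - of_int k)) \<le> C)"

lemma bounded_periodization_nonneg: "bounded_periodization f \<Longrightarrow> 0 \<le> f x"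
  by (simp add: bounded_periodization_def)

lemma bounded_periodization_bounded:
  assumes "bounded_periodization f"
  shows "bounded (range f)"
proof -
  obtain C where C: "\<And>x F. finite F \<Longrightarrow> (\<Sum>k\<in>F. f (x - of_int k)) \<le> C"
    using assms unfolding bounded_periodization_def by blast
  have "\<bar>f x\<bar> \<le> C" for x
    using C[of "{0}" x] bounded_periodization_nonneg[OF assms] by simp
  then show ?thesis
    by (auto simp: bounded_iff)
qed

lemma bounded_periodization_summable:
  assumes "bounded_periodization f"
  shows "(\<lambda>k. f (x - of_int k)) summable_on UNIV"
proof -
  obtain C where "\<And>x F. finite F \<Longrightarrow> (\<Sum>k\<in>F. f (x - of_int k)) \<le> C"
    using assms unfolding bounded_periodization_def by blast
  then have "bdd_above (sum (\<lambda>k. f (x - of_int k)) ` {F. F \<subseteq> UNIV \<and> finite F})"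
    by (intro bdd_aboveI[of _ C]) auto
  then show ?thesis
    using bounded_periodization_nonneg[OF assms] by (intro nonneg_bdd_above_summable_on)
qed

lemma bounded_periodization_infsum:
  assumes "bounded_periodization f"
  obtains C where "\<And>x. (\<Sum>\<^sub>\<infinity>k. f (x - of_int k)) \<le> C"
proof -
  obtain C where "\<And>x F. finite F \<Longrightarrow> (\<Sum>k\<in>F. f (x - of_int k)) \<le> C"
    using assms unfolding bounded_periodization_def by blast
  then show ?thesis
    by (intro that[of C] infsum_le_finite_sums bounded_periodization_summable[OF assms]) auto
qed

lemma bounded_periodization_cmult:
  assumes "bounded_periodization f" "0 \<le> A"
  shows "bounded_periodization (\<lambda>x. A * f x)"
proof -
  obtain C where "\<And>x F. finite F \<Longrightarrow> (\<Sum>k\<in>F. f (x - of_int k)) \<le> C"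
    using assms(1) unfolding bounded_periodization_def by blast
  then have "(\<Sum>k\<in>F. A * f (x - of_int k)) \<le> A * C" if "finite F" for x F
    using that assms(2) by (simp add: mult_left_mono flip: sum_distrib_left)
  then show ?thesis
    using assms bounded_periodization_nonneg unfolding bounded_periodization_def by auto
qed

lemma summable_on_bounded_mult:
  fixes c :: "'a \<Rightarrow> 'b::{real_normed_algebra_1, banach}" and f :: "'a \<Rightarrow> real"
  assumes f: "f summable_on A" "\<And>k. 0 \<le> f k" and "bounded (range c)"
  shows "(\<lambda>k. c k * of_real (f k)) summable_on A"
proof -
  obtain B where B: "\<And>k. norm (c k) \<le> B"
    using assms(3) by (auto simp: bounded_iff)
  have "norm (c k * of_real (f k)) \<le> norm (c k) * f k" for k
    using norm_mult_ineq[of "c k" "of_real (f k)"] f(2) by simp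
  also have "norm (c k) * f k \<le> B * f k" for k
    by (intro mult_right_mono B f(2))
  finally show ?thesis
    by (rule abs_summable_summable[OF Infinite_Sum.abs_summable_on_comparison_test'[OF
          summable_on_cmult_right[OF f(1)]]])
qed

lemma summable_translates_bounded_coeff:
  fixes c :: "int \<Rightarrow> 'a::{real_normed_algebra_1, banach}"
  assumes f: "bounded_periodization f" and c: "bounded (range c)"
  shows "(\<lambda>k. c k * of_real (f (x - of_int k))) summable_on UNIV"
  by (rule summable_on_bounded_mult[OF bounded_periodization_summable[OF f]
        bounded_periodization_nonneg[OF f] c])

lemma summable_on_geometric_int:
  fixes q :: real
  assumes "0 \<le> q" "q < 1"
  shows "(\<lambda>k::int. q ^ nat \<bar>k\<bar>) summable_on UNIV"
proof -
  have nat: "(\<lambda>n. q ^ n) summable_on UNIV"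
    using assms by (intro summable_nonneg_imp_summable_on summable_geometric) auto
  have "(\<lambda>k. q ^ nat \<bar>k\<bar>) summable_on range int" "(\<lambda>k. q ^ nat \<bar>k\<bar>) summable_on range (\<lambda>n. - int n)"
    using nat by (subst summable_on_reindex; simp add: inj_def o_def)+
  then have "(\<lambda>k. q ^ nat \<bar>k\<bar>) summable_on (range int \<union> range (\<lambda>n. - int n))"
    by (rule summable_on_union)
  moreover have "k \<in> range int \<union> range (\<lambda>n. - int n)" for k
    by (cases k rule: int_cases2) auto
  then have "range int \<union> range (\<lambda>n. - int n) = UNIV"
    by blast
  ultimately show ?thesis
    by simp
qed

lemma summable_on_exp_minus_square_int:
  assumes "b > 0"
  shows "(\<lambda>k::int. exp (- b * (of_int k)\<^sup>2 :: real)) summable_on UNIV"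
proof (rule summable_on_comparison_test)
  show "(\<lambda>k::int. exp (- b) ^ nat \<bar>k\<bar>) summable_on UNIV"
    using assms by (intro summable_on_geometric_int) auto
  fix k :: int
  have "\<bar>k\<bar> \<le> k\<^sup>2"
    using self_le_power[of "\<bar>k\<bar>" 2] by (cases "k = 0") auto
  then have "b * real_of_int \<bar>k\<bar> \<le> b * (of_int k)\<^sup>2"
    using assms by (metis less_imp_le mult_left_mono of_int_le_iff of_int_power)
  moreover have "exp (- b) ^ nat \<bar>k\<bar> = exp (- (b * real_of_int \<bar>k\<bar>))"
    using exp_of_nat_mult[of "nat \<bar>k\<bar>" "- b"] by (simp add: mult.commute)
  ultimately show "exp (- b * (of_int k)\<^sup>2) \<le> exp (- b) ^ nat \<bar>k\<bar>"
    by simp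
qed auto

lemma exp_shifted_square_le:
  fixes a :: real
  assumes "a > 0"
  shows "exp (- a * (x - k)\<^sup>2) \<le> exp (a * x\<^sup>2) * exp (- (a / 2) * k\<^sup>2)"
proof -
  have "0 \<le> a * ((2 * x - k)\<^sup>2 / 2)"
    using assms by simp
  then show ?thesis
    by (simp add: exp_add[symmetric] power2_eq_square algebra_simps)
qed

lemma bounded_periodization_gauss:
  assumes "a > 0"
  shows "bounded_periodization (\<lambda>x. exp (- a * x\<^sup>2))"
  unfolding bounded_periodization_def
proof (intro conjI allI exI impI)
  fix x :: real and F :: "int set" assume F: "finite F"
  define G where "G = (\<lambda>k. k - \<lfloor>x\<rfloor>) ` F"
  have "exp (a * (frac x)\<^sup>2) \<le> exp a"
    using assms frac_lt_1[of x] by (simp add: power_le_one less_imp_le)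
  then have le: "exp (- a * (frac x - of_int k)\<^sup>2) \<le> exp a * exp (- (a / 2) * (of_int k)\<^sup>2)" for k :: int
    using exp_shifted_square_le[OF assms, of "frac x" "of_int k"]
    by (meson exp_ge_zero mult_right_mono order_trans)
  have "(\<Sum>k\<in>F. exp (- a * (x - of_int k)\<^sup>2)) = (\<Sum>k\<in>G. exp (- a * (frac x - of_int k)\<^sup>2))"
    unfolding G_def by (subst sum.reindex) (auto simp: inj_on_def frac_def algebra_simps)
  also have "\<dots> \<le> (\<Sum>k\<in>G. exp a * exp (- (a / 2) * (of_int k)\<^sup>2))"
    by (intro sum_mono le)
  also have "\<dots> \<le> (\<Sum>\<^sub>\<infinity>k::int. exp a * exp (- (a / 2) * (of_int k)\<^sup>2))"
    using F assms
    by (intro finite_sum_le_infsum summable_on_cmult_right summable_on_exp_minus_square_int)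
      (auto simp: G_def)
  finally show "(\<Sum>k\<in>F. exp (- a * (x - of_int k)\<^sup>2)) \<le>
      (\<Sum>\<^sub>\<infinity>k::int. exp a * exp (- (a / 2) * (of_int k)\<^sup>2))" .
qed simp

section \<open>Restrictions of entire functions to the real line\<close>

definition bounded_smooth :: "(real \<Rightarrow> real) \<Rightarrow> bool" where
  "bounded_smooth f \<longleftrightarrow> smooth f \<and> (\<forall>i. bounded (range ((deriv ^^ i) f)))"

lemma bounded_smooth_higher_deriv:
  assumes "bounded_smooth f"
  shows "((deriv ^^ i) f has_real_derivative (deriv ^^ Suc i) f x) (at x)"
    and "bounded (range ((deriv ^^ i) f))"
    and "continuous_on UNIV ((deriv ^^ i) f)"
    and "(deriv ^^ i) f \<in> borel_measurable borel"
proof -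
  show der: "((deriv ^^ i) f has_real_derivative (deriv ^^ Suc i) f x) (at x)" for x
    using assms unfolding bounded_smooth_def smooth_def by blast
  show "bounded (range ((deriv ^^ i) f))"
    using assms unfolding bounded_smooth_def by blast
  show "continuous_on UNIV ((deriv ^^ i) f)"
    using der DERIV_isCont continuous_at_imp_continuous_on by blast
  then show "(deriv ^^ i) f \<in> borel_measurable borel"
    by (rule borel_measurable_continuous_onI)
qed

lemmas bounded_smoothD = bounded_smooth_higher_deriv[where i = 0, simplified]

lemma
  assumes F: "F holomorphic_on UNIV" and real: "\<And>x. F (of_real x) = of_real (f x)"
  shows smooth_of_real_restriction: "smooth f"
    and higher_deriv_of_real: "(deriv ^^ i) F (of_real x) = of_real ((deriv ^^ i) f x)"
proof -
  define u where "u i x = Re ((deriv ^^ i) F (of_real x))" for i x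
  have der: "((\<lambda>x. (deriv ^^ i) F (of_real x)) has_vector_derivative
      (deriv ^^ Suc i) F (of_real x)) (at x)" for i x
    using holomorphic_derivI[OF holomorphic_higher_deriv[OF F open_UNIV] open_UNIV UNIV_I,
        of i "of_real x" UNIV]
    by (simp add: has_vector_derivative_real_field)
  then have der_u: "(u i has_real_derivative u (Suc i) x) (at x)" for i x
    unfolding u_def by (rule has_field_derivative_Re)
  have "u 0 = f"
    by (simp add: u_def real fun_eq_iff)
  then have u: "(deriv ^^ i) f = u i" for i
    using higher_deriv_eqI[of u, OF der_u] by simp
  then show "smooth f"
    using der_u unfolding smooth_def by metis
  have "Im ((deriv ^^ i) F (of_real x)) = 0" for x
  proof (induction i arbitrary: x)
    case 0
    then show ?case by (simp add: real)
  next
    case (Suc i)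
    have "((\<lambda>x. Im ((deriv ^^ i) F (of_real x))) has_real_derivative
        Im ((deriv ^^ Suc i) F (of_real x))) (at x)"
      by (rule has_field_derivative_Im[OF der])
    then show ?case
      unfolding Suc by (metis DERIV_const DERIV_unique)
  qed
  then show "(deriv ^^ i) F (of_real x) = of_real ((deriv ^^ i) f x)"
    by (simp add: u u_def complex_eq_iff)
qed

lemma bounded_smooth_of_real_restriction:
  assumes F: "F holomorphic_on UNIV" and real: "\<And>x. F (of_real x) = of_real (f x)"
    and bound: "\<And>z. \<bar>Im z\<bar> \<le> 1 \<Longrightarrow> norm (F z) \<le> B"
  shows "bounded_smooth f"
  unfolding bounded_smooth_def
proof (intro conjI allI)
  show "smooth f"
    by (rule smooth_of_real_restriction[OF F real])
  fix i
  have "\<bar>(deriv ^^ i) f x\<bar> \<le> fact i * B" for x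
  proof -
    have "norm ((deriv ^^ i) F (of_real x)) \<le> fact i * B / 1 ^ i"
    proof (rule Cauchy_inequality)
      fix z assume "norm (complex_of_real x - z) = 1"
      then show "norm (F z) \<le> B"
        using abs_Im_le_cmod[of "complex_of_real x - z"] by (intro bound) simp
    qed (use F in \<open>auto intro: holomorphic_on_subset holomorphic_on_imp_continuous_on\<close>)
    then show ?thesis
      by (simp add: higher_deriv_of_real[OF F real])
  qed
  then show "bounded (range ((deriv ^^ i) f))"
    by (auto simp: bounded_iff)
qed

lemma bounded_smooth_gauss:
  assumes "a > 0"
  shows "bounded_smooth (\<lambda>x. A * exp (- a * x\<^sup>2))"
proof (rule bounded_smooth_of_real_restriction)
  let ?F = "\<lambda>z. of_real A * exp (- of_real a * z\<^sup>2)"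
  show "?F holomorphic_on UNIV"
    by (intro holomorphic_intros)
  show "?F (of_real x) = of_real (A * exp (- a * x\<^sup>2))" for x
    by (simp add: exp_of_real[symmetric])
  fix z assume "\<bar>Im z\<bar> \<le> 1"
  then have "(Im z)\<^sup>2 \<le> 1"
    by (simp add: abs_square_le_1)
  then have "(Im z)\<^sup>2 - (Re z)\<^sup>2 \<le> 1"
    using zero_le_power2[of "Re z"] by linarith
  then have "a * ((Im z)\<^sup>2 - (Re z)\<^sup>2) \<le> a"
    using assms by (intro mult_left_le) simp_all
  then show "norm (?F z) \<le> \<bar>A\<bar> * exp a"
    by (auto simp: norm_mult norm_exp_eq_Re power2_eq_square algebra_simps intro!: mult_left_mono)
qed

section \<open>Series of Gaussian shifts\<close>

definition gauss_series :: "real \<Rightarrow> (int \<Rightarrow> real) \<Rightarrow> complex \<Rightarrow> complex" where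
  "gauss_series a c z = (\<Sum>\<^sub>\<infinity>k. of_real (c k) * exp (- of_real a * (z - of_int k)\<^sup>2))"

lemma norm_exp_minus_square:
  "norm (exp (- of_real a * (z - of_int k)\<^sup>2)) = exp (a * (Im z)\<^sup>2) * exp (- a * (Re z - of_int k)\<^sup>2)"
  by (simp add: norm_exp_eq_Re power2_eq_square algebra_simps flip: exp_add)

lemma gauss_series_of_real:
  assumes "a > 0" and c: "bounded (range c)"
  shows "gauss_series a c (of_real x) = of_real (\<Sum>\<^sub>\<infinity>k. c k * exp (- a * (x - of_int k)\<^sup>2))"
proof -
  have "(\<lambda>k. c k * exp (- a * (x - of_int k)\<^sup>2)) summable_on UNIV"
    using summable_translates_bounded_coeff[OF bounded_periodization_gauss[OF \<open>a > 0\<close>] c] by simp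
  then have "((\<lambda>k. complex_of_real (c k * exp (- a * (x - of_int k)\<^sup>2))) has_sum
      of_real (\<Sum>\<^sub>\<infinity>k. c k * exp (- a * (x - of_int k)\<^sup>2))) UNIV"
    by (intro has_sum_of_real has_sum_infsum)
  then show ?thesis
    unfolding gauss_series_def by (simp add: infsumI exp_of_real[symmetric])
qed

lemma norm_gauss_series_le:
  assumes "a > 0" and c: "bounded (range c)"
  obtains C where "C \<ge> 0" "\<And>z. norm (gauss_series a c z) \<le> C * exp (a * (Im z)\<^sup>2)"
proof -
  obtain B where B: "\<And>k. \<bar>c k\<bar> \<le> B"
    using c by (auto simp: bounded_iff)
  have "B \<ge> 0"
    using B[of 0] by linarith
  note gauss = bounded_periodization_gauss[OF \<open>a > 0\<close>]
  obtain \<Theta> where \<Theta>: "\<And>x. (\<Sum>\<^sub>\<infinity>k::int. exp (- a * (x - of_int k)\<^sup>2)) \<le> \<Theta>"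
    using bounded_periodization_infsum[OF gauss] by blast
  have bound: "norm (gauss_series a c z) \<le> (B * \<Theta>) * exp (a * (Im z)\<^sup>2)" for z
  proof -
    let ?g = "\<lambda>k::int. (B * exp (a * (Im z)\<^sup>2)) * exp (- a * (Re z - of_int k)\<^sup>2)"
    have g: "?g summable_on UNIV"
      by (intro summable_on_cmult_right bounded_periodization_summable[OF gauss])
    have le: "norm (of_real (c k) * exp (- of_real a * (z - of_int k)\<^sup>2)) \<le> ?g k" for k
      using B[of k] by (simp only: norm_mult norm_exp_minus_square norm_of_real mult.assoc)
        (intro mult_right_mono, auto)
    have "norm (gauss_series a c z) \<le> infsum ?g UNIV"
      unfolding gauss_series_def
      using abs_summable_summable[OF Infinite_Sum.abs_summable_on_comparison_test'[OF g le]]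
      by (intro norm_infsum_le[OF has_sum_infsum has_sum_infsum[OF g] le])
    also have "\<dots> = (B * exp (a * (Im z)\<^sup>2)) * (\<Sum>\<^sub>\<infinity>k::int. exp (- a * (Re z - of_int k)\<^sup>2))"
      by (rule infsum_cmult_right')
    also have "\<dots> \<le> (B * exp (a * (Im z)\<^sup>2)) * \<Theta>"
      using \<open>B \<ge> 0\<close> by (intro mult_left_mono \<Theta>) auto
    finally show ?thesis
      by (simp add: mult_ac)
  qed
  moreover have "B * \<Theta> \<ge> 0"
    using order_trans[OF norm_ge_zero bound[of 0]] by simp
  ultimately show ?thesis
    using that by blast
qed

lemma holomorphic_gauss_series:
  assumes "a > 0" and c: "bounded (range c)"
  shows "gauss_series a c holomorphic_on UNIV"
proof -
  obtain B where B: "\<And>k. \<bar>c k\<bar> \<le> B"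
    using c by (auto simp: bounded_iff)
  have "gauss_series a c holomorphic_on ball z 1" for z
  proof (rule holomorphic_uniform_limit)
    let ?f = "\<lambda>k z. complex_of_real (c k) * exp (- of_real a * (z - of_int k)\<^sup>2)"
    define R where "R = norm z + 1"
    define m where "m k = B * (exp (a * R\<^sup>2) * (exp (a * R\<^sup>2) * exp (- (a / 2) * (of_int k)\<^sup>2)))" for k :: int
    show "uniform_limit (cball z 1) (\<lambda>X w. \<Sum>k\<in>X. ?f k w) (gauss_series a c) (finite_subsets_at_top UNIV)"
      unfolding gauss_series_def
    proof (rule Weierstrass_m_test_general)
      show "m summable_on UNIV"
        unfolding m_def using \<open>a > 0\<close>
        by (intro summable_on_cmult_right summable_on_exp_minus_square_int) simp
      fix k w assume "w \<in> cball z 1"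
      then have "norm w \<le> R"
        using norm_triangle_ineq2[of w z] by (simp add: R_def dist_norm norm_minus_commute)
      then have "(Re w)\<^sup>2 \<le> R\<^sup>2" "(Im w)\<^sup>2 \<le> R\<^sup>2"
        using abs_Re_le_cmod[of w] abs_Im_le_cmod[of w] by (simp_all flip: abs_le_square_iff)
      then have le: "exp (a * (Im w)\<^sup>2) * exp (- a * (Re w - of_int k)\<^sup>2) \<le>
          exp (a * R\<^sup>2) * (exp (a * R\<^sup>2) * exp (- (a / 2) * (of_int k)\<^sup>2))"
        using exp_shifted_square_le[OF \<open>a > 0\<close>, of "Re w" "of_int k"] \<open>a > 0\<close>
        by (intro mult_mono) (auto elim!: order_trans intro!: mult_right_mono)
      then show "norm (?f k w) \<le> m k"
        using B[of k] unfolding m_def norm_mult norm_exp_minus_square by (intro mult_mono[OF _ le]) auto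
    qed
    show "\<forall>\<^sub>F X in finite_subsets_at_top UNIV.
        continuous_on (cball z 1) (\<lambda>w. \<Sum>k\<in>X. ?f k w) \<and> (\<lambda>w. \<Sum>k\<in>X. ?f k w) holomorphic_on ball z 1"
      by (intro always_eventually allI conjI continuous_intros holomorphic_intros)
  qed auto
  then have "gauss_series a c analytic_on UNIV"
    unfolding analytic_on_def using zero_less_one by blast
  then show ?thesis
    by (rule analytic_imp_holomorphic)
qed

lemma bounded_smooth_gauss_series:
  assumes "a > 0" "bounded (range c)"
  shows "bounded_smooth (\<lambda>x. \<Sum>\<^sub>\<infinity>k. c k * exp (- a * (x - of_int k)\<^sup>2))"
proof -
  obtain C where "C \<ge> 0" and C: "\<And>z. norm (gauss_series a c z) \<le> C * exp (a * (Im z)\<^sup>2)"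
    using norm_gauss_series_le[OF assms] by blast
  have "norm (gauss_series a c z) \<le> C * exp a" if "\<bar>Im z\<bar> \<le> 1" for z
  proof -
    have "a * (Im z)\<^sup>2 \<le> a"
      using that assms(1) by (simp add: abs_square_le_1)
    then have "C * exp (a * (Im z)\<^sup>2) \<le> C * exp a"
      using \<open>C \<ge> 0\<close> by (intro mult_left_mono) auto
    with C[of z] show ?thesis
      by (rule order_trans)
  qed
  then show ?thesis
    by (rule bounded_smooth_of_real_restriction[OF holomorphic_gauss_series[OF assms]
          gauss_series_of_real[OF assms]])
qed

definition theta_series :: "real \<Rightarrow> (int \<Rightarrow> real) \<Rightarrow> complex \<Rightarrow> complex" where
  "theta_series a c z = exp (of_real a * z\<^sup>2) * gauss_series a c z"

lemma holomorphic_theta_series: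
  assumes "a > 0" "bounded (range c)"
  shows "theta_series a c holomorphic_on UNIV"
  unfolding theta_series_def[abs_def] by (intro holomorphic_intros holomorphic_gauss_series assms)

lemma theta_series_of_real:
  assumes "a > 0" "bounded (range c)"
  shows "theta_series a c (of_real x) =
    of_real (exp (a * x\<^sup>2) * (\<Sum>\<^sub>\<infinity>k. c k * exp (- a * (x - of_int k)\<^sup>2)))"
  by (simp add: theta_series_def gauss_series_of_real[OF assms] flip: exp_of_real)

lemma theta_series_eq:
  "theta_series a c z = (\<Sum>\<^sub>\<infinity>k. of_real (c k) * exp (of_real a * (2 * z * of_int k - (of_int k)\<^sup>2)))"
  unfolding theta_series_def gauss_series_def infsum_cmult_right'[symmetric]
  by (intro infsum_cong) (simp add: power2_eq_square algebra_simps flip: exp_add)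

lemma theta_series_periodic:
  assumes "a > 0"
  shows "theta_series a c (z + \<i> * of_real (pi / a)) = theta_series a c z"
proof -
  have "exp (of_real a * (2 * (z + \<i> * of_real (pi / a)) * of_int k - (of_int k)\<^sup>2)) =
      exp (of_real a * (2 * z * of_int k - (of_int k)\<^sup>2))" for k
    unfolding exp_eq using assms by (intro exI[of _ k]) (simp add: field_simps)
  then show ?thesis
    unfolding theta_series_eq by simp
qed

lemma norm_theta_series_le:
  assumes "a > 0" "bounded (range c)"
  obtains C where "C \<ge> 0" "\<And>z. norm (theta_series a c z) \<le> C * exp (a * (Re z)\<^sup>2)"
proof -
  obtain C where "C \<ge> 0" and C: "\<And>z. norm (gauss_series a c z) \<le> C * exp (a * (Im z)\<^sup>2)"
    using norm_gauss_series_le[OF assms] by blast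
  have "norm (theta_series a c z) \<le> C * exp (a * (Re z)\<^sup>2)" for z
  proof -
    have "norm (theta_series a c z) \<le> norm (exp (of_real a * z\<^sup>2)) * (C * exp (a * (Im z)\<^sup>2))"
      unfolding theta_series_def norm_mult by (intro mult_left_mono C) simp
    also have "\<dots> = C * exp (a * (Re z)\<^sup>2)"
      by (simp add: norm_exp_eq_Re power2_eq_square algebra_simps flip: exp_add)
    finally show ?thesis .
  qed
  then show ?thesis
    by (rule that[OF \<open>C \<ge> 0\<close>])
qed

lemma theta_series_bigo_power:
  assumes "a > 0" "bounded (range c)"
    and "vanishes_on (\<lambda>x. \<Sum>\<^sub>\<infinity>k. c k * exp (- a * (x - of_int k)\<^sup>2)) Z"
  shows "theta_series a c \<in> O[at (of_real y)](\<lambda>z. (z - of_real y) ^ count Z y)"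
proof -
  have "(deriv ^^ i) (gauss_series a c) (of_real y) = 0" if "i < count Z y" for i
    using higher_deriv_of_real[OF holomorphic_gauss_series gauss_series_of_real, OF assms(1,2,1,2)]
      assms(3) that
    by (simp add: vanishes_on_def)
  then have "gauss_series a c \<in> O[at (of_real y)](\<lambda>z. (z - of_real y) ^ count Z y)"
    by (intro holomorphic_bigo_power[OF holomorphic_gauss_series[OF assms(1,2)] open_UNIV UNIV_I])
  moreover have "(\<lambda>z. exp (of_real a * z\<^sup>2)) \<in> O[at (of_real y)](\<lambda>_. 1 :: complex)"
    by (intro continuous_imp_bigo_1 continuous_intros)
  ultimately show ?thesis
    unfolding theta_series_def[abs_def] using landau_o.big_mult by fastforce
qed

theorem gauss_series_eq_0_if_many_zeros:
  fixes c :: "int \<Rightarrow> real"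
  assumes "a > 0" and c: "bounded (range c)"
    and f: "f = (\<lambda>x. \<Sum>\<^sub>\<infinity>k. c k * exp (- a * (x - of_int k)\<^sup>2))"
    and r: "r > 0" "real M > 2 * r" and zeros: "\<And>x. has_zeros f M {x - r..x + r}"
  shows "f x = 0"
proof -
  obtain L where L: "2 * r < L" "L < M"
    using dense[OF r(2)] by blast
  then have "L > 0"
    using r(1) by linarith
  obtain C where "C \<ge> 0" and C: "\<And>z. norm (theta_series a c z) \<le> C * exp (a * (Re z)\<^sup>2)"
    using norm_theta_series_le[OF assms(1) c] by blast
  have periodic: "norm (theta_series a c (z + \<i> * of_real (pi / a))) = norm (theta_series a c z)" for z
    by (simp only: theta_series_periodic[OF assms(1)])
  have "theta_series a c (of_real x) = 0"
  proof (rule gauss_growth_eq_0_if_many_zeros[OF assms(1) holomorphic_theta_series[OF assms(1) c]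
        periodic \<open>C \<ge> 0\<close> C \<open>L > 0\<close>])
    show "real (2 * M) > 2 * L"
      using L(2) by simp
    fix n
    obtain Z where Z: "vanishes_on f Z" "size Z = 2 * M * n" "\<And>y. y \<in># Z \<Longrightarrow> \<bar>y\<bar> < real n * L"
      "(\<Sum>y\<in>#Z. \<bar>y\<bar>) \<le> real (2 * M) * L * (real n * (real n + 1) / 2)"
      using vanishes_on_layers[OF has_zeros_layer[OF zeros r(1) L(1)] \<open>L > 0\<close>] by metis
    then show "\<exists>Z. size Z = 2 * M * n \<and> (\<Sum>y\<in>#Z. \<bar>y\<bar>) \<le> real (2 * M) * L * (real n * (real n + 1) / 2) \<and>
        (\<forall>y\<in>#Z. \<bar>y\<bar> \<le> real n * L \<and>
          theta_series a c \<in> O[at (of_real y)](\<lambda>z. (z - of_real y) ^ count Z y))"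
      using theta_series_bigo_power[OF assms(1) c] unfolding f
      by (intro exI[of _ Z]) (auto simp: less_imp_le)
  qed
  then show ?thesis
    by (simp add: f theta_series_of_real[OF assms(1) c])
qed

section \<open>Averages over the exponential distribution\<close>

definition exp_measure :: "real measure" where
  "exp_measure = density lborel (\<lambda>s. ennreal (exponential_density 1 s))"

text \<open>The bounded solution \<open>v\<close> of \<open>v + d v' = f\<close>; this form treats all signs of \<^term>\<open>d\<close>, and
  \<^prop>\<open>d = 0\<close>, uniformly.\<close>

definition exp_avg :: "real \<Rightarrow> (real \<Rightarrow> real) \<Rightarrow> real \<Rightarrow> real" where
  "exp_avg d f x = (\<integral>s. f (x - d * s) \<partial>exp_measure)"

interpretation exp_measure: prob_space exp_measure
  unfolding exp_measure_def by (rule prob_space_exponential_density) simp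

lemma sets_exp_measure [simp, measurable_cong]: "sets exp_measure = sets borel"
  by (simp add: exp_measure_def)

lemma
  fixes f :: "real \<Rightarrow> 'a::{banach, second_countable_topology}"
  assumes [measurable]: "f \<in> borel_measurable borel"
  shows integral_exp_measure: "(\<integral>s. f s \<partial>exp_measure) = (LBINT s:{0<..}. exp (- s) *\<^sub>R f s)"
    and integrable_exp_measure_iff:
      "integrable exp_measure f \<longleftrightarrow> set_integrable lborel {0<..} (\<lambda>s. exp (- s) *\<^sub>R f s)"
proof -
  have AE: "AE s in lborel. exponential_density 1 s *\<^sub>R f s = indicator {0<..} s *\<^sub>R exp (- s) *\<^sub>R f s"
    using AE_lborel_singleton[of "0::real"]
    by (auto simp: exponential_density_def indicator_def elim!: eventually_mono)
  have "(\<integral>s. f s \<partial>exp_measure) = (\<integral>s. exponential_density 1 s *\<^sub>R f s \<partial>lborel)"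
    unfolding exp_measure_def by (rule integral_density) (auto simp: exponential_density_nonneg)
  also have "\<dots> = (LBINT s:{0<..}. exp (- s) *\<^sub>R f s)"
    unfolding set_lebesgue_integral_def by (rule integral_cong_AE) (use AE in auto)
  finally show "(\<integral>s. f s \<partial>exp_measure) = (LBINT s:{0<..}. exp (- s) *\<^sub>R f s)" .
  have "integrable exp_measure f \<longleftrightarrow> integrable lborel (\<lambda>s. exponential_density 1 s *\<^sub>R f s)"
    unfolding exp_measure_def by (rule integrable_density) (auto simp: exponential_density_nonneg)
  also have "\<dots> \<longleftrightarrow> set_integrable lborel {0<..} (\<lambda>s. exp (- s) *\<^sub>R f s)"
    unfolding set_integrable_def by (rule integrable_cong_AE) (use AE in auto)
  finally show "integrable exp_measure f \<longleftrightarrow> set_integrable lborel {0<..} (\<lambda>s. exp (- s) *\<^sub>R f s)" .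
qed

lemma integrable_exp_measure_bounded:
  fixes f :: "real \<Rightarrow> 'a::{banach, second_countable_topology}"
  assumes "f \<in> borel_measurable borel" "bounded (range f)"
  shows "integrable exp_measure f"
proof -
  obtain B where "\<And>s. norm (f s) \<le> B"
    using assms(2) by (auto simp: bounded_iff)
  then have "AE s in exp_measure. norm (f s) \<le> B"
    by simp
  then show ?thesis
    by (rule exp_measure.integrable_const_bound) (use assms(1) in simp)
qed

lemma integral_exp_measure_diff_deriv:
  fixes F F' :: "real \<Rightarrow> 'a::euclidean_space"
  assumes der: "\<And>s. (F has_vector_derivative F' s) (at s)" and cont: "continuous_on UNIV F'"
    and bounded: "bounded (range F)" "bounded (range F')"
  shows "(\<integral>s. F s - F' s \<partial>exp_measure) = F 0"
proof -
  have "continuous_on UNIV F"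
    by (intro continuous_at_imp_continuous_on ballI has_vector_derivative_continuous[OF der])
  with cont have isCont: "isCont F s" "isCont F' s" for s
    by (simp_all add: continuous_on_eq_continuous_at)
  have "continuous_on UNIV (\<lambda>s. F s - F' s)"
    by (intro continuous_on_diff \<open>continuous_on UNIV F\<close> cont)
  note meas = borel_measurable_continuous_onI[OF this]
  have einterval: "einterval 0 \<infinity> = {0::real<..}"
    by (auto simp: einterval_def zero_ereal_def)
  obtain B where B: "\<And>s. norm (F s) \<le> B"
    using bounded(1) by (auto simp: bounded_iff)
  have "(\<integral>s. F s - F' s \<partial>exp_measure) = (LBINT s=0..\<infinity>. exp (- s) *\<^sub>R (F s - F' s))"
    by (simp add: integral_exp_measure[OF meas] interval_lebesgue_integral_0_infty)
  also have "\<dots> = 0 - (- F 0)"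
  proof (rule interval_integral_FTC_integrable[where F = "\<lambda>s. - (exp (- s) *\<^sub>R F s)"])
    show "((\<lambda>s. - (exp (- s) *\<^sub>R F s)) has_vector_derivative exp (- s) *\<^sub>R (F s - F' s)) (at s)" for s
      by (auto intro!: derivative_eq_intros der simp: algebra_simps)
    show "isCont (\<lambda>s. exp (- s) *\<^sub>R (F s - F' s)) s" for s
      by (intro continuous_intros isCont)
    have "bounded (range (\<lambda>s. F s - F' s))"
      by (rule bounded_minus_comp[OF bounded])
    then show "set_integrable lborel (einterval 0 \<infinity>) (\<lambda>s. exp (- s) *\<^sub>R (F s - F' s))"
      unfolding einterval integrable_exp_measure_iff[OF meas, symmetric]
      by (rule integrable_exp_measure_bounded[OF meas])
    have "((\<lambda>s. - (exp (- s) *\<^sub>R F s)) \<longlongrightarrow> - (exp (- 0) *\<^sub>R F 0)) (at_right 0)"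
      by (intro tendsto_intros isCont_tendsto_compose[OF isCont(1)])
    then show "(((\<lambda>s. - (exp (- s) *\<^sub>R F s)) \<circ> real_of_ereal) \<longlongrightarrow> - F 0) (at_right 0)"
      unfolding zero_ereal_def by (simp add: ereal_tendsto_simps1)
    have "((\<lambda>s. - (exp (- s) *\<^sub>R F s)) \<longlongrightarrow> 0) at_top"
    proof (rule Lim_null_comparison)
      show "\<forall>\<^sub>F s in at_top. norm (- (exp (- s) *\<^sub>R F s)) \<le> exp (- s) * B"
        by (simp add: B)
      show "((\<lambda>s. exp (- s) * B) \<longlongrightarrow> 0) at_top"
        by real_asymp
    qed
    then show "(((\<lambda>s. - (exp (- s) *\<^sub>R F s)) \<circ> real_of_ereal) \<longlongrightarrow> 0) (at_left \<infinity>)"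
      by (simp add: ereal_tendsto_simps1)
  qed simp
  finally show ?thesis
    by simp
qed

lemma integral_exp_measure_cis:
  "(\<integral>s. cis (- (d * s)) \<partial>exp_measure) = inverse (1 + \<i> * complex_of_real d)"
proof -
  have "(\<integral>s. cis (- (d * s)) - (- \<i> * of_real d) * cis (- (d * s)) \<partial>exp_measure) = cis (- (d * 0))"
  proof (rule integral_exp_measure_diff_deriv)
    fix s
    have "((\<lambda>z. exp (- \<i> * of_real d * z)) has_field_derivative
        - \<i> * of_real d * exp (- \<i> * of_real d * of_real s)) (at (of_real s))"
      by (auto intro!: derivative_eq_intros)
    from has_vector_derivative_real_field[OF this]
    show "((\<lambda>s. cis (- (d * s))) has_vector_derivative - \<i> * of_real d * cis (- (d * s))) (at s)"
      by (simp add: cis_conv_exp mult.assoc)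
  qed (auto intro!: continuous_intros simp: bounded_iff norm_mult)
  also have "(\<lambda>s. cis (- (d * s)) - (- \<i> * of_real d) * cis (- (d * s))) =
      (\<lambda>s. (1 + \<i> * of_real d) * cis (- (d * s)))"
    by (simp add: algebra_simps)
  finally have "(1 + \<i> * complex_of_real d) * (\<integral>s. cis (- (d * s)) \<partial>exp_measure) = 1"
    by simp
  then show ?thesis
    by (rule inverse_unique[symmetric])
qed

lemma integrable_exp_avg:
  fixes f :: "real \<Rightarrow> real"
  assumes "f \<in> borel_measurable borel" "bounded (range f)"
  shows "integrable exp_measure (\<lambda>s. f (x - d * s))"
proof (rule integrable_exp_measure_bounded)
  show "bounded (range (\<lambda>s. f (x - d * s)))"
    using assms(2) by (rule bounded_subset) auto
qed (use assms(1) in simp)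

lemma bounded_exp_avg:
  assumes meas: "f \<in> borel_measurable borel" and bounded: "bounded (range f)"
  shows "bounded (range (exp_avg d f))"
proof -
  obtain B where B: "\<And>x. \<bar>f x\<bar> \<le> B"
    using bounded by (auto simp: bounded_iff)
  have "\<bar>exp_avg d f x\<bar> \<le> B" for x
  proof -
    have "\<bar>exp_avg d f x\<bar> \<le> (\<integral>s. \<bar>f (x - d * s)\<bar> \<partial>exp_measure)"
      unfolding exp_avg_def by (rule integral_abs_bound)
    also have "\<dots> \<le> B"
      using integrable_exp_avg[OF assms] B by (intro exp_measure.integral_le_const) auto
    finally show ?thesis .
  qed
  then show ?thesis
    by (auto simp: bounded_iff)
qed

lemma exp_avg_add_deriv:
  assumes der: "\<And>x. (f has_real_derivative f' x) (at x)" and cont: "continuous_on UNIV f'"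
    and "bounded (range f)" "bounded (range f')"
  shows "exp_avg d f x + d * exp_avg d f' x = f x"
proof -
  have "continuous_on UNIV f"
    using der DERIV_isCont continuous_at_imp_continuous_on by blast
  note meas = borel_measurable_continuous_onI[OF this] borel_measurable_continuous_onI[OF cont]
  have "exp_avg d f x + d * exp_avg d f' x = (\<integral>s. f (x - d * s) - - d * f' (x - d * s) \<partial>exp_measure)"
    unfolding exp_avg_def
    using integrable_exp_avg[OF meas(1) assms(3), of x d] integrable_exp_avg[OF meas(2) assms(4), of x d]
    by simp
  also have "\<dots> = f (x - d * 0)"
  proof (rule integral_exp_measure_diff_deriv)
    show "((\<lambda>s. f (x - d * s)) has_vector_derivative - d * f' (x - d * s)) (at s)" for s
      unfolding has_real_derivative_iff_has_vector_derivative[symmetric]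
      by (rule DERIV_cong[OF DERIV_chain2[OF der, where g = "\<lambda>s. x - d * s" and Db = "- d"]])
        (auto intro!: derivative_eq_intros)
    show "continuous_on UNIV (\<lambda>s. - d * f' (x - d * s))"
      by (intro continuous_intros continuous_on_compose2[OF cont]) auto
    show "bounded (range (\<lambda>s. - d * f' (x - d * s)))"
      using bounded_scaling[OF assms(4), of "- d"] by (rule bounded_subset) auto
  qed (use assms(3) in \<open>auto intro: bounded_subset\<close>)
  finally show ?thesis
    by simp
qed

lemma has_real_derivative_integral:
  fixes f f' :: "real \<Rightarrow> 'a \<Rightarrow> real"
  assumes int: "\<And>x. integrable M (f x)"
    and der: "\<And>x s. ((\<lambda>x. f x s) has_real_derivative f' x s) (at x)"
    and bound: "\<And>x s. \<bar>f' x s\<bar> \<le> w s" "integrable M w"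
    and meas: "f' x \<in> borel_measurable M"
  shows "((\<lambda>x. \<integral>s. f x s \<partial>M) has_real_derivative (\<integral>s. f' x s \<partial>M)) (at x)"
  unfolding has_field_derivative_iff tendsto_at_iff_sequentially
proof (intro allI impI)
  fix X :: "nat \<Rightarrow> real" assume X: "\<forall>n. X n \<in> UNIV - {x}" "X \<longlonglongrightarrow> x"
  let ?q = "\<lambda>n s. (f (X n) s - f x s) / (X n - x)"
  have "(\<lambda>n. \<integral>s. ?q n s \<partial>M) \<longlonglongrightarrow> (\<integral>s. f' x s \<partial>M)"
  proof (rule integral_dominated_convergence[OF meas _ bound(2)])
    show "AE s in M. (\<lambda>n. ?q n s) \<longlonglongrightarrow> f' x s"
      using der X unfolding has_field_derivative_iff tendsto_at_iff_sequentially by (auto simp: o_def)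
    show "AE s in M. norm (?q n s) \<le> w s" for n
    proof (intro AE_I2)
      fix s
      have "norm (f (X n) s - f x s) \<le> w s * norm (X n - x)"
        by (rule field_differentiable_bound[where f' = "\<lambda>x. f' x s" and S = UNIV])
          (auto intro: has_field_derivative_at_within der bound(1))
      then show "norm (?q n s) \<le> w s"
        using X(1) by (simp add: abs_divide divide_le_eq)
    qed
    show "?q n \<in> borel_measurable M" for n
      using int by (intro borel_measurable_divide borel_measurable_diff borel_measurable_const)
        (auto dest: borel_measurable_integrable)
  qed
  moreover have "(\<integral>s. ?q n s \<partial>M) = ((\<integral>s. f (X n) s \<partial>M) - (\<integral>s. f x s \<partial>M)) / (X n - x)" for n
    using Bochner_Integration.integral_diff[OF int int] by simp
  ultimately show "((\<lambda>y. ((\<integral>s. f y s \<partial>M) - (\<integral>s. f x s \<partial>M)) / (y - x)) \<circ> X) \<longlonglongrightarrow> (\<integral>s. f' x s \<partial>M)"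
    by (simp only: o_def)
qed

lemma DERIV_exp_avg:
  assumes der: "\<And>x. (f has_real_derivative f' x) (at x)"
    and f': "f' \<in> borel_measurable borel" "bounded (range f')" and "bounded (range f)"
  shows "(exp_avg d f has_real_derivative exp_avg d f' x) (at x)"
proof -
  obtain B where B: "\<And>x. \<bar>f' x\<bar> \<le> B"
    using f'(2) by (auto simp: bounded_iff)
  have "continuous_on UNIV f"
    using der DERIV_isCont continuous_at_imp_continuous_on by blast
  then have "integrable exp_measure (\<lambda>s. f (x - d * s))" for x
    by (intro integrable_exp_avg borel_measurable_continuous_onI assms(4))
  then show ?thesis
    unfolding exp_avg_def[abs_def]
  proof (rule has_real_derivative_integral)
    show "((\<lambda>x. f (x - d * s)) has_real_derivative f' (x - d * s)) (at x)" for x s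
      by (rule DERIV_cong[OF DERIV_chain2[OF der, where g = "\<lambda>x. x - d * s" and Db = 1]])
        (auto intro!: derivative_eq_intros)
  qed (use B f'(1) in auto)
qed

lemma
  assumes f: "bounded_smooth f"
  shows higher_deriv_exp_avg: "(deriv ^^ i) (exp_avg d f) = exp_avg d ((deriv ^^ i) f)"
    and bounded_smooth_exp_avg: "bounded_smooth (exp_avg d f)"
proof -
  have der: "(exp_avg d ((deriv ^^ i) f) has_real_derivative exp_avg d ((deriv ^^ Suc i) f) x) (at x)" for i x
    by (intro DERIV_exp_avg bounded_smooth_higher_deriv f)
  show eq: "(deriv ^^ i) (exp_avg d f) = exp_avg d ((deriv ^^ i) f)" for i
    using higher_deriv_eqI[of "\<lambda>i. exp_avg d ((deriv ^^ i) f)", OF der] by simp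
  show "bounded_smooth (exp_avg d f)"
    unfolding bounded_smooth_def smooth_def eq
    by (intro conjI allI der bounded_exp_avg bounded_smooth_higher_deriv f)
qed

lemma has_zeros_exp_avg:
  assumes f: "bounded_smooth f" and "has_zeros (exp_avg d f) (Suc N) {a..b}"
  shows "has_zeros f N {a..b}"
proof -
  have "has_zeros (\<lambda>x. exp_avg d f x + d * deriv (exp_avg d f) x) N {a..b}"
    using bounded_smooth_exp_avg[OF f] assms(2)
    by (intro has_zeros_add_deriv) (simp_all add: bounded_smooth_def)
  also have "deriv (exp_avg d f) = exp_avg d (deriv f)"
    using higher_deriv_exp_avg[OF f, of 1] by simp
  also have "(\<lambda>x. exp_avg d f x + d * exp_avg d (deriv f) x) = f"
    using bounded_smoothD[OF f] bounded_smooth_higher_deriv[OF f, of 1]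
    by (intro ext exp_avg_add_deriv) simp_all
  finally show ?thesis .
qed

lemma bounded_smooth_exp_avgs: "bounded_smooth f \<Longrightarrow> bounded_smooth (foldr exp_avg ds f)"
  by (induction ds) (simp_all add: bounded_smooth_exp_avg)

lemma has_zeros_exp_avgs:
  assumes f: "bounded_smooth f"
  shows "has_zeros (foldr exp_avg ds f) (N + length ds) {a..b} \<Longrightarrow> has_zeros f N {a..b}"
  by (induction ds) (auto dest: has_zeros_exp_avg[OF bounded_smooth_exp_avgs[OF f]])

lemma exp_avgs_zero: "foldr exp_avg ds (\<lambda>x. 0) = (\<lambda>x. 0)"
  by (induction ds) (auto simp: exp_avg_def)

lemma borel_measurable_exp_avg [measurable]:
  assumes [measurable]: "f \<in> borel_measurable borel"
  shows "exp_avg d f \<in> borel_measurable borel"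
  unfolding exp_avg_def[abs_def] by measurable

lemma borel_measurable_exp_avgs [measurable]:
  "f \<in> borel_measurable borel \<Longrightarrow> foldr exp_avg ds f \<in> borel_measurable borel"
  by (induction ds) simp_all

lemma bounded_periodization_exp_avg:
  assumes meas: "f \<in> borel_measurable borel" and f: "bounded_periodization f"
  shows "bounded_periodization (exp_avg d f)"
proof -
  obtain C where C: "\<And>x F. finite F \<Longrightarrow> (\<Sum>k\<in>F. f (x - of_int k)) \<le> C"
    using f unfolding bounded_periodization_def by blast
  have int: "integrable exp_measure (\<lambda>s. f (x - d * s - of_int k))" for x k
    using integrable_exp_avg[OF meas bounded_periodization_bounded[OF f], of "x - of_int k" d]
    by (simp add: algebra_simps)
  have "(\<Sum>k\<in>F. exp_avg d f (x - of_int k)) \<le> C" if "finite F" for x F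
  proof -
    have "(\<Sum>k\<in>F. exp_avg d f (x - of_int k)) = (\<integral>s. (\<Sum>k\<in>F. f (x - d * s - of_int k)) \<partial>exp_measure)"
      using int unfolding exp_avg_def
      by (subst Bochner_Integration.integral_sum) (simp_all add: algebra_simps)
    also have "\<dots> \<le> C"
      using int C[OF that]
      by (intro exp_measure.integral_le_const Bochner_Integration.integrable_sum) simp_all
    finally show ?thesis .
  qed
  moreover have "0 \<le> exp_avg d f x" for x
    using bounded_periodization_nonneg[OF f] by (simp add: exp_avg_def)
  ultimately show ?thesis
    unfolding bounded_periodization_def by blast
qed

lemma bounded_periodization_exp_avgs:
  assumes "f \<in> borel_measurable borel" "bounded_periodization f"
  shows "bounded_periodization (foldr exp_avg ds f)"
  using assms by (induction ds) (simp_all add: bounded_periodization_exp_avg)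

lemma
  fixes f :: "'a \<Rightarrow> real"
  assumes "f summable_on A"
  shows integrable_count_space_if_summable_on: "integrable (count_space A) f"
    and integral_count_space_eq_infsum: "(\<integral>k. f k \<partial>count_space A) = infsum f A"
proof -
  have "Infinite_Set_Sum.abs_summable_on f A"
    using assms abs_summable_equivalent summable_on_iff_abs_summable_on_real by blast
  then show "integrable (count_space A) f" "(\<integral>k. f k \<partial>count_space A) = infsum f A"
    using infsetsum_infsum by (auto simp: abs_summable_on_def infsetsum_def)
qed

lemma exp_avg_infsum:
  assumes meas [measurable]: "f \<in> borel_measurable borel" and f: "bounded_periodization f"
    and c: "bounded (range c)"
  shows "exp_avg d (\<lambda>x. \<Sum>\<^sub>\<infinity>k. c k * f (x - of_int k)) x = (\<Sum>\<^sub>\<infinity>k. c k * exp_avg d f (x - of_int k))"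
proof -
  interpret E: pair_sigma_finite "count_space (UNIV :: int set)" exp_measure
    by (intro pair_sigma_finite.intro sigma_finite_measure_count_space exp_measure.sigma_finite_measure_axioms)
  note avg = bounded_periodization_exp_avg[OF meas f, of d]
  let ?F = "\<lambda>k s. c k * f (x - of_int k - d * s)"
  have "integrable (count_space UNIV \<Otimes>\<^sub>M exp_measure) (case_prod ?F)"
  proof (rule E.Fubini_integrable)
    show "case_prod ?F \<in> borel_measurable (count_space UNIV \<Otimes>\<^sub>M exp_measure)"
      by (rule measurable_pair_measure_countable1) auto
    have "bounded (range (\<lambda>k. \<bar>c k\<bar>))"
      using c by (auto simp: bounded_iff)
    then have "(\<lambda>k. \<bar>c k\<bar> * exp_avg d f (x - of_int k)) summable_on UNIV"
      using summable_translates_bounded_coeff[OF avg] by fastforce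
    then show "integrable (count_space UNIV) (\<lambda>k. \<integral>s. norm (case_prod ?F (k, s)) \<partial>exp_measure)"
      using bounded_periodization_nonneg[OF f]
      by (simp add: integrable_count_space_if_summable_on abs_mult exp_avg_def)
    show "AE k in count_space UNIV. integrable exp_measure (\<lambda>s. case_prod ?F (k, s))"
      using integrable_exp_avg[OF meas bounded_periodization_bounded[OF f]] by simp
  qed
  then have swap: "(\<integral>s. (\<integral>k. ?F k s \<partial>count_space UNIV) \<partial>exp_measure) =
      (\<integral>k. (\<integral>s. ?F k s \<partial>exp_measure) \<partial>count_space UNIV)"
    by (rule E.Fubini_integral)
  have "(\<Sum>\<^sub>\<infinity>k. c k * f (x - d * s - of_int k)) = (\<integral>k. ?F k s \<partial>count_space UNIV)" for s
    using integral_count_space_eq_infsum[OF summable_translates_bounded_coeff[OF f c, of "x - d * s"]]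
    by (simp add: algebra_simps)
  then have "exp_avg d (\<lambda>x. \<Sum>\<^sub>\<infinity>k. c k * f (x - of_int k)) x =
      (\<integral>s. (\<integral>k. ?F k s \<partial>count_space UNIV) \<partial>exp_measure)"
    by (simp add: exp_avg_def)
  also have "\<dots> = (\<integral>k. c k * exp_avg d f (x - of_int k) \<partial>count_space UNIV)"
    unfolding swap by (simp add: exp_avg_def)
  also have "\<dots> = (\<Sum>\<^sub>\<infinity>k. c k * exp_avg d f (x - of_int k))"
    using integral_count_space_eq_infsum[OF summable_translates_bounded_coeff[OF avg c]] by simp
  finally show ?thesis .
qed

lemma exp_avgs_infsum:
  assumes "f \<in> borel_measurable borel" "bounded_periodization f" "bounded (range c)"
  shows "foldr exp_avg ds (\<lambda>x. \<Sum>\<^sub>\<infinity>k. c k * f (x - of_int k)) =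
    (\<lambda>x. \<Sum>\<^sub>\<infinity>k. c k * foldr exp_avg ds f (x - of_int k))"
proof (induction ds)
  case (Cons d ds)
  show ?case
    unfolding foldr.simps o_apply Cons
    by (intro ext exp_avg_infsum borel_measurable_exp_avgs bounded_periodization_exp_avgs assms)
qed simp

section \<open>Fourier transforms\<close>

lemma borel_measurable_cis [measurable]: "cis \<in> borel_measurable borel"
  by (intro borel_measurable_continuous_onI continuous_intros)

lemma integrable_times_cis:
  assumes "integrable lborel f" and [measurable]: "h \<in> borel_measurable lborel"
  shows "integrable lborel (\<lambda>x. complex_of_real (f x) * cis (h x))"
  by (rule Bochner_Integration.integrable_bound[OF assms(1)])
    (use borel_measurable_integrable[OF assms(1)] in \<open>auto simp: norm_mult\<close>)

lemma fourier_diff: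
  assumes "integrable lborel f" "integrable lborel g"
  shows "fourier (\<lambda>x. f x - g x) \<xi> = fourier f \<xi> - fourier g \<xi>"
  unfolding fourier_def of_real_diff left_diff_distrib
  by (intro Bochner_Integration.integral_diff integrable_times_cis assms) simp_all

lemma fourier_cmult: "fourier (\<lambda>x. c * f x) \<xi> = of_real c * fourier f \<xi>"
  by (simp add: fourier_def mult.assoc)

lemma integral_lborel_translate:
  fixes f :: "real \<Rightarrow> 'a :: {banach, second_countable_topology}"
  shows "(\<integral>x. f (x - t) \<partial>lborel) = (\<integral>x. f x \<partial>lborel)"
  using lborel_integral_real_affine[of 1 f "- t"] by (simp add: algebra_simps)

lemma integrable_lborel_translate:
  fixes f :: "real \<Rightarrow> 'a :: {banach, second_countable_topology}"
  shows "integrable lborel f \<Longrightarrow> integrable lborel (\<lambda>x. f (x - t))"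
  using lborel_integrable_real_affine[of f 1 "- t"] by (simp add: algebra_simps)

lemma fourier_translate: "fourier (\<lambda>x. f (x - t)) \<xi> = cis (- (2 * pi * t * \<xi>)) * fourier f \<xi>"
proof -
  let ?h = "\<lambda>x. complex_of_real (f x) * cis (- 2 * pi * x * \<xi>)"
  have "cis (- 2 * pi * x * \<xi>) = cis (- (2 * pi * t * \<xi>)) * cis (- 2 * pi * (x - t) * \<xi>)" for x
    by (simp add: cis_mult algebra_simps)
  then have "fourier (\<lambda>x. f (x - t)) \<xi> = (\<integral>x. cis (- (2 * pi * t * \<xi>)) * ?h (x - t) \<partial>lborel)"
    unfolding fourier_def by (simp only: mult_ac)
  also have "\<dots> = cis (- (2 * pi * t * \<xi>)) * (\<integral>x. ?h (x - t) \<partial>lborel)"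
    by (rule integral_mult_right_zero)
  also have "(\<integral>x. ?h (x - t) \<partial>lborel) = fourier f \<xi>"
    unfolding fourier_def by (rule integral_lborel_translate)
  finally show ?thesis .
qed

interpretation exp_lborel: pair_sigma_finite exp_measure lborel ..

lemma integrable_exp_lborel_translate_times_cis:
  assumes f: "integrable lborel f" and [measurable]: "h \<in> borel_measurable borel"
  shows "integrable (exp_measure \<Otimes>\<^sub>M lborel) (\<lambda>(s, x). complex_of_real (f (x - d * s)) * cis (h x))"
proof (rule exp_lborel.Fubini_integrable)
  let ?F = "\<lambda>(s, x). complex_of_real (f (x - d * s)) * cis (h x)"
  have [measurable]: "f \<in> borel_measurable borel"
    using f by simp
  show "?F \<in> borel_measurable (exp_measure \<Otimes>\<^sub>M lborel)"
    by measurable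
  show "integrable exp_measure (\<lambda>s. \<integral>x. norm (?F (s, x)) \<partial>lborel)"
    using integral_lborel_translate[of "\<lambda>x. \<bar>f x\<bar>"] by (simp add: norm_mult)
  show "AE s in exp_measure. integrable lborel (\<lambda>x. ?F (s, x))"
    by (simp add: integrable_times_cis integrable_lborel_translate f)
qed

lemma
  assumes f: "integrable lborel f"
  shows integrable_lborel_exp_avg: "integrable lborel (exp_avg d f)"
    and fourier_exp_avg: "fourier (exp_avg d f) \<xi> =
          inverse (1 + 2 * pi * \<i> * complex_of_real (d * \<xi>)) * fourier f \<xi>"
proof -
  note int = integrable_exp_lborel_translate_times_cis[OF f, of _ d]
  have "integrable lborel (\<lambda>x. \<integral>s. complex_of_real (f (x - d * s)) * cis 0 \<partial>exp_measure)"
    using exp_lborel.integrable_snd[OF int[of "\<lambda>_. 0"]] by simp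
  then show "integrable lborel (exp_avg d f)"
    by (simp add: exp_avg_def[abs_def] complex_of_real_integrable_eq)
  let ?F = "\<lambda>s x. complex_of_real (f (x - d * s)) * cis (- 2 * pi * x * \<xi>)"
  have "fourier (exp_avg d f) \<xi> = (\<integral>x. (\<integral>s. ?F s x \<partial>exp_measure) \<partial>lborel)"
    unfolding fourier_def exp_avg_def by simp
  also have "\<dots> = (\<integral>s. fourier (\<lambda>x. f (x - d * s)) \<xi> \<partial>exp_measure)"
    unfolding fourier_def by (intro exp_lborel.Fubini_integral int) simp
  also have "\<dots> = (\<integral>s. cis (- ((2 * pi * d * \<xi>) * s)) \<partial>exp_measure) * fourier f \<xi>"
    by (simp add: fourier_translate mult_ac)
  finally show "fourier (exp_avg d f) \<xi> = inverse (1 + 2 * pi * \<i> * complex_of_real (d * \<xi>)) * fourier f \<xi>"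
    unfolding integral_exp_measure_cis by (simp add: mult_ac)
qed

lemma
  assumes "integrable lborel f"
  shows integrable_exp_avgs: "integrable lborel (foldr exp_avg ds f)"
    and fourier_exp_avgs: "fourier (foldr exp_avg ds f) \<xi> =
      (\<Prod>d\<leftarrow>ds. inverse (1 + 2 * pi * \<i> * complex_of_real (d * \<xi>))) * fourier f \<xi>"
proof -
  show int: "integrable lborel (foldr exp_avg ds f)" for ds
    by (induction ds) (simp_all add: assms integrable_lborel_exp_avg)
  show "fourier (foldr exp_avg ds f) \<xi> =
      (\<Prod>d\<leftarrow>ds. inverse (1 + 2 * pi * \<i> * complex_of_real (d * \<xi>))) * fourier f \<xi>"
    by (induction ds) (simp_all add: fourier_exp_avg[OF int])
qed

lemma char_density_lborel:
  assumes [measurable]: "p \<in> borel_measurable borel" and "\<And>x. 0 \<le> p x"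
  shows "char (density lborel (\<lambda>x. ennreal (p x))) t = fourier p (- t / (2 * pi))"
proof -
  have "char (density lborel (\<lambda>x. ennreal (p x))) t = (\<integral>x. p x *\<^sub>R cis (t * x) \<partial>lborel)"
    unfolding char_def cis_conv_exp[symmetric] by (rule integral_density) (use assms(2) in auto)
  then show ?thesis
    by (simp add: fourier_def scaleR_conv_of_real mult.commute)
qed

lemma real_distribution_density_lborel:
  assumes "integrable lborel p" "\<And>x. 0 \<le> p x" "(\<integral>x. p x \<partial>lborel) = 1"
  shows "real_distribution (density lborel (\<lambda>x. ennreal (p x)))"
proof -
  have "(\<integral>\<^sup>+x. ennreal (p x) \<partial>lborel) = 1"
    using assms nn_integral_eq_integral[of lborel p] by simp
  then have "prob_space (density lborel (\<lambda>x. ennreal (p x)))"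
    using assms(1) by (intro prob_spaceI) (simp add: emeasure_density)
  then show ?thesis
    unfolding real_distribution_def real_distribution_axioms_def by simp
qed

lemma AE_eq_if_fourier_eq_nonneg:
  assumes int: "integrable lborel p" "integrable lborel q"
    and nonneg: "\<And>x. 0 \<le> p x" "\<And>x. 0 \<le> q x" and eq: "\<And>\<xi>. fourier p \<xi> = fourier q \<xi>"
  shows "AE x in lborel. p x = q x"
proof (cases "(\<integral>x. p x \<partial>lborel) = 0")
  case True
  moreover have "(\<integral>x. p x \<partial>lborel) = (\<integral>x. q x \<partial>lborel)"
    using eq[of 0] by (simp add: fourier_def)
  ultimately have "AE x in lborel. p x = 0" "AE x in lborel. q x = 0"
    using integral_nonneg_eq_0_iff_AE[OF int(1)] integral_nonneg_eq_0_iff_AE[OF int(2)] nonneg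
    by simp_all
  then show ?thesis
    by eventually_elim simp
next
  case False
  define I where "I = (\<integral>x. p x \<partial>lborel)"
  have "I \<ge> 0"
    using nonneg(1) by (simp add: I_def)
  then have I: "I > 0" "I = (\<integral>x. q x \<partial>lborel)"
    using False eq[of 0] by (simp_all add: I_def fourier_def)
  let ?d = "\<lambda>f. density lborel (\<lambda>x. ennreal (f x / I))"
  have meas [measurable]: "p \<in> borel_measurable borel" "q \<in> borel_measurable borel"
    using int by simp_all
  have "?d p = ?d q"
  proof (rule Levy_uniqueness)
    have "fourier (\<lambda>x. p x / I) \<xi> = fourier (\<lambda>x. q x / I) \<xi>" for \<xi>
      using eq[of \<xi>] fourier_cmult[of "1 / I"] by simp
    then show "char (?d p) = char (?d q)"
      using I(1) nonneg by (intro ext) (simp add: char_density_lborel)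
    show "real_distribution (?d p)" "real_distribution (?d q)"
      using I int nonneg by (auto intro!: real_distribution_density_lborel simp: I_def)
  qed
  then have "AE x in lborel. ennreal (p x / I) = ennreal (q x / I)"
    by (subst (asm) sigma_finite_measure.density_unique_iff[OF sigma_finite_lborel]) auto
  then show ?thesis
    by eventually_elim (use I(1) nonneg in \<open>simp add: ennreal_inj\<close>)
qed

lemma AE_eq_if_fourier_eq:
  assumes int: "integrable lborel f" "integrable lborel g" and eq: "\<And>\<xi>. fourier f \<xi> = fourier g \<xi>"
  shows "AE x in lborel. f x = g x"
proof -
  define u v where "u x = max 0 (f x) + max 0 (- g x)" and "v x = max 0 (g x) + max 0 (- f x)" for x
  have uv: "u x - v x = f x - g x" "0 \<le> u x" "0 \<le> v x" for x
    by (auto simp: u_def v_def)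
  have int_uv: "integrable lborel u" "integrable lborel v"
    unfolding u_def v_def using int by simp_all
  have "fourier u \<xi> - fourier v \<xi> = fourier f \<xi> - fourier g \<xi>" for \<xi>
    using fourier_diff[OF int_uv, of \<xi>] fourier_diff[OF int, of \<xi>] by (simp add: uv(1))
  then have "AE x in lborel. u x = v x"
    using int_uv uv(2,3) eq by (intro AE_eq_if_fourier_eq_nonneg) simp_all
  then show ?thesis
    by eventually_elim (metis eq_iff_diff_eq_0 uv(1))
qed

lemma continuous_AE_eq_imp_eq:
  fixes f g :: "'a::euclidean_space \<Rightarrow> 'b::t2_space"
  assumes cont: "continuous_on UNIV f" "continuous_on UNIV g" and AE: "AE x in lborel. f x = g x"
  shows "f = g"
proof -
  have opn: "open {x. f x \<noteq> g x}"
    using cont by (rule open_Collect_neq)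
  have "{x. f x \<noteq> g x} \<in> null_sets lborel"
    by (subst AE_iff_null_sets) (use AE opn in auto)
  then have "negligible {x. f x \<noteq> g x}"
    by (simp add: negligible_iff_null_sets null_sets_completionI)
  then have "{x. f x \<noteq> g x} = {}"
    using opn open_not_negligible by blast
  then show ?thesis
    by auto
qed

lemma
  assumes "a > 0"
  shows integrable_gauss: "integrable lborel (\<lambda>x. exp (- a * x\<^sup>2))"
    and fourier_gauss: "fourier (\<lambda>x. exp (- a * x\<^sup>2)) \<xi> =
      of_real (sqrt (pi / a) * exp (- (pi\<^sup>2 / a) * \<xi>\<^sup>2))"
proof -
  define \<kappa> where "\<kappa> = sqrt (2 * a)"
  have \<kappa>: "\<kappa> > 0" "\<kappa>\<^sup>2 = 2 * a"
    using assms by (simp_all add: \<kappa>_def)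
  have gauss: "exp (- a * x\<^sup>2) = sqrt (2 * pi) * std_normal_density (0 + \<kappa> * x)" for x
    by (simp add: std_normal_density_def power_mult_distrib \<kappa>(2))
  have "integrable lborel (\<lambda>x. std_normal_density (0 + \<kappa> * x))"
    using \<kappa>(1) by (intro lborel_integrable_real_affine) (auto simp: integrable_normal_density)
  then show "integrable lborel (\<lambda>x. exp (- a * x\<^sup>2))"
    unfolding gauss by (intro integrable_mult_right)
  define t where "t = - 2 * pi * \<xi> / \<kappa>"
  have t2: "t\<^sup>2 / 2 = pi\<^sup>2 / a * \<xi>\<^sup>2"
    by (simp add: t_def power_divide power_mult_distrib \<kappa>(2))
  have "of_real (exp (- t\<^sup>2 / 2)) = char std_normal_distribution t"
    by (simp add: char_std_normal_distribution)
  also have "\<dots> = (\<integral>x. std_normal_density x *\<^sub>R cis (t * x) \<partial>lborel)"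
    unfolding char_def cis_conv_exp[symmetric] by (rule integral_density) auto
  also have "\<dots> = \<bar>\<kappa>\<bar> *\<^sub>R (\<integral>x. std_normal_density (0 + \<kappa> * x) *\<^sub>R cis (t * (0 + \<kappa> * x)) \<partial>lborel)"
    by (rule lborel_integral_real_affine) (use \<kappa>(1) in simp)
  also have "\<dots> = of_real (\<kappa> / sqrt (2 * pi)) * fourier (\<lambda>x. exp (- a * x\<^sup>2)) \<xi>"
  proof -
    have "std_normal_density (0 + \<kappa> * x) *\<^sub>R cis (t * (0 + \<kappa> * x)) =
        of_real (1 / sqrt (2 * pi)) * (of_real (exp (- a * x\<^sup>2)) * cis (- 2 * pi * x * \<xi>))" for x
      unfolding gauss using \<kappa>(1) by (simp add: t_def scaleR_conv_of_real mult_ac)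
    then show ?thesis
      using \<kappa>(1) by (simp only: integral_mult_right_zero fourier_def) (simp add: scaleR_conv_of_real)
  qed
  finally have "fourier (\<lambda>x. exp (- a * x\<^sup>2)) \<xi> = of_real (sqrt (2 * pi) / \<kappa> * exp (- (pi\<^sup>2 / a) * \<xi>\<^sup>2))"
    using \<kappa>(1) t2 by (simp add: field_simps)
  also have "sqrt (2 * pi) / \<kappa> = sqrt (pi / a)"
    using assms by (simp add: \<kappa>_def real_sqrt_divide real_sqrt_mult)
  finally show "fourier (\<lambda>x. exp (- a * x\<^sup>2)) \<xi> = of_real (sqrt (pi / a) * exp (- (pi\<^sup>2 / a) * \<xi>\<^sup>2))" .
qed

section \<open>Totally positive generators of Gaussian type\<close>

lemma TP_gaussian_type_eq_exp_avgs:
  assumes "TP_gaussian_type g"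
  obtains ds a A where "a > 0" "A > 0" "g = foldr exp_avg ds (\<lambda>x. A * exp (- a * x\<^sup>2))"
proof -
  obtain n and \<delta> :: "nat \<Rightarrow> real" and c
    where g: "continuous_on UNIV g" "integrable lborel g" and "c > 0"
      and fourier_g: "\<And>\<xi>. fourier g \<xi> = (\<Prod>j<n. inverse (1 + 2 * pi * \<i> * complex_of_real (\<delta> j * \<xi>)))
        * complex_of_real (exp (- c * \<xi>\<^sup>2))"
    using assms unfolding TP_gaussian_type_def by blast
  define a where "a = pi\<^sup>2 / c"
  define A where "A = 1 / sqrt (pi / a)"
  define ds where "ds = map \<delta> [0..<n]"
  let ?\<phi> = "\<lambda>x. A * exp (- a * x\<^sup>2)"
  have "a > 0" "A > 0" and a: "pi\<^sup>2 / a = c"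
    using \<open>c > 0\<close> by (simp_all add: a_def A_def)
  have \<phi>: "integrable lborel ?\<phi>"
    by (intro integrable_mult_right integrable_gauss \<open>a > 0\<close>)
  have "fourier ?\<phi> \<xi> = of_real (exp (- c * \<xi>\<^sup>2))" for \<xi>
    unfolding fourier_cmult fourier_gauss[OF \<open>a > 0\<close>] a using \<open>a > 0\<close> by (simp add: A_def)
  then have "fourier g \<xi> = fourier (foldr exp_avg ds ?\<phi>) \<xi>" for \<xi>
    unfolding fourier_exp_avgs[OF \<phi>] fourier_g
    using prod.distinct_set_conv_list[of "[0..<n]"] by (simp add: ds_def lessThan_atLeast0 o_def)
  then have "AE x in lborel. g x = foldr exp_avg ds ?\<phi> x"
    by (intro AE_eq_if_fourier_eq g integrable_exp_avgs \<phi>)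
  then have "g = foldr exp_avg ds ?\<phi>"
    by (intro continuous_AE_eq_imp_eq g bounded_smoothD bounded_smooth_exp_avgs bounded_smooth_gauss
        \<open>a > 0\<close>)
  then show ?thesis
    by (rule that[OF \<open>a > 0\<close> \<open>A > 0\<close>])
qed

lemma bounded_periodization_TP_gaussian_type:
  assumes "TP_gaussian_type g"
  shows "bounded_periodization g"
proof -
  obtain ds a A where "a > 0" "A > 0" and g: "g = foldr exp_avg ds (\<lambda>x. A * exp (- a * x\<^sup>2))"
    by (rule TP_gaussian_type_eq_exp_avgs[OF assms])
  have "0 \<le> A"
    using \<open>A > 0\<close> by simp
  then show ?thesis
    unfolding g by (intro bounded_periodization_exp_avgs bounded_smoothD(4) bounded_smooth_gauss
        bounded_periodization_cmult bounded_periodization_gauss \<open>a > 0\<close>)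
qed

lemma translate_series_eq_0_if_dense_zeros:
  fixes f g :: "real \<Rightarrow> real"
  assumes TP: "TP_gaussian_type g" and c: "bounded (range c)"
    and f: "f = (\<lambda>x. \<Sum>\<^sub>\<infinity>k. c k * g (x - of_int k))"
    and dens: "lower_density S m > 1"
    and zero: "\<And>y. y \<in> S \<Longrightarrow> f y = 0"
    and mult: "\<And>y i. y \<in> S \<Longrightarrow> i < m y \<Longrightarrow> (deriv ^^ i) f y = 0"
  shows "f x = 0"
proof -
  obtain ds a A where "a > 0" "A > 0" and g: "g = foldr exp_avg ds (\<lambda>x. A * exp (- a * x\<^sup>2))"
    by (rule TP_gaussian_type_eq_exp_avgs[OF TP])
  define h where "h = (\<lambda>x. \<Sum>\<^sub>\<infinity>k. (c k * A) * exp (- a * (x - of_int k)\<^sup>2))"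
  have cA: "bounded (range (\<lambda>k. c k * A))"
    using bounded_scaling[OF c, of A] by (simp add: image_image mult.commute)
  have h: "bounded_smooth h"
    unfolding h_def by (rule bounded_smooth_gauss_series[OF \<open>a > 0\<close> cA])
  let ?\<phi> = "\<lambda>x. A * exp (- a * x\<^sup>2)"
  have "?\<phi> \<in> borel_measurable borel"
    by (intro bounded_smoothD(4) bounded_smooth_gauss \<open>a > 0\<close>)
  moreover have "bounded_periodization ?\<phi>"
    by (rule bounded_periodization_cmult[OF bounded_periodization_gauss[OF \<open>a > 0\<close>]])
      (use \<open>A > 0\<close> in simp)
  ultimately have f_h: "f = foldr exp_avg ds h"
    using exp_avgs_infsum[of ?\<phi> c ds] c by (simp add: f g h_def mult.assoc)
  obtain r M where r: "r > 0" "real M > 2 * r"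
    and zeros: "\<And>x. has_zeros f (M + length ds) {x - r..x + r}"
    by (rule has_zeros_if_lower_density_gt_1[OF dens, of f "length ds"])
      (use zero mult that in blast)+
  have "has_zeros h M {x - r..x + r}" for x
    using zeros unfolding f_h by (rule has_zeros_exp_avgs[OF h])
  then have "h x = 0" for x
    by (rule gauss_series_eq_0_if_many_zeros[OF \<open>a > 0\<close> cA h_def r])
  then have "h = (\<lambda>x. 0)"
    by auto
  then show ?thesis
    by (simp add: f_h exp_avgs_zero)
qed

lemma V_infty_cmult:
  assumes "f \<in> V_infty g"
  shows "(\<lambda>x. b * f x) \<in> V_infty g"
proof -
  obtain c where "bounded (range c)" and f: "\<And>x. f x = (\<Sum>\<^sub>\<infinity>k. c k * complex_of_real (g (x - of_int k)))"
    using assms unfolding V_infty_def by blast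
  then have "bounded (range (\<lambda>k. b * c k))"
    using bounded_linear_image[OF _ bounded_linear_mult_right, of "range c" b] by (simp add: image_image)
  then show ?thesis
    unfolding V_infty_def f infsum_cmult_right'[symmetric] mult.assoc[symmetric] by blast
qed

lemma Re_V_infty_eq_0_if_dense_zeros:
  assumes TP: "TP_gaussian_type g" and "f \<in> V_infty g" and dens: "lower_density S m > 1"
    and zero: "\<And>y. y \<in> S \<Longrightarrow> Re (f y) = 0"
    and mult: "\<And>y i. y \<in> S \<Longrightarrow> i < m y \<Longrightarrow> (deriv ^^ i) (\<lambda>x. Re (f x)) y = 0"
  shows "Re (f x) = 0"
proof -
  obtain c where c: "bounded (range c)"
    and f: "\<And>x. f x = (\<Sum>\<^sub>\<infinity>k. c k * complex_of_real (g (x - of_int k)))"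
    using assms(2) unfolding V_infty_def by blast
  have "bounded (range (\<lambda>k. Re (c k)))"
    using bounded_linear_image[OF c bounded_linear_Re] by (simp add: image_image)
  moreover have "(\<lambda>x. Re (f x)) = (\<lambda>x. \<Sum>\<^sub>\<infinity>k. Re (c k) * g (x - of_int k))"
    unfolding f
    using summable_translates_bounded_coeff[OF bounded_periodization_TP_gaussian_type[OF TP] c]
    by (simp flip: infsum_Re)
  ultimately show ?thesis
    by (rule translate_series_eq_0_if_dense_zeros[OF TP _ _ dens]) (use zero mult in blast)+
qed

theorem theorem4p9:
  fixes g :: "real \<Rightarrow> real"
  assumes "TP_gaussian_type g"
  shows "(\<forall>f::real \<Rightarrow> real.
            (\<lambda>x. complex_of_real (f x)) \<in> V_infty g \<and> (\<exists>x. f x \<noteq> 0) \<longrightarrow>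
            lower_density {x. f x = 0} (vanishing_order f) \<le> 1)
       \<and> (\<forall>\<Lambda>::real set. lower_density_set \<Lambda> > 1 \<longrightarrow>
            (\<forall>f \<in> V_infty g. (\<forall>y\<in>\<Lambda>. f y = 0) \<longrightarrow> (\<forall>x. f x = 0)))"
proof (intro conjI allI impI ballI)
  fix f :: "real \<Rightarrow> real"
  assume f: "(\<lambda>x. complex_of_real (f x)) \<in> V_infty g \<and> (\<exists>x. f x \<noteq> 0)"
  show "lower_density {x. f x = 0} (vanishing_order f) \<le> 1"
  proof (rule ccontr)
    assume "\<not> lower_density {x. f x = 0} (vanishing_order f) \<le> 1"
    then have dens: "lower_density {x. f x = 0} (vanishing_order f) > 1"
      by simp
    have "Re (of_real (f x)) = 0" for x
      by (rule Re_V_infty_eq_0_if_dense_zeros[OF assms conjunct1[OF f] dens])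
        (auto simp: vanishing_order_def dest: not_less_Least)
    with f show False
      by simp
  qed
next
  fix \<Lambda> and f :: "real \<Rightarrow> complex" and x
  assume dens: "lower_density_set \<Lambda> > 1" and f: "f \<in> V_infty g" and zero: "\<forall>y\<in>\<Lambda>. f y = 0"
  note vanish = Re_V_infty_eq_0_if_dense_zeros[OF assms _ dens[unfolded lower_density_set_def]]
  have "Re (f x) = 0"
    by (rule vanish[OF f]) (use zero in simp_all)
  moreover have "Re (- \<i> * f x) = 0"
    by (rule vanish[OF V_infty_cmult[OF f]]) (use zero in simp_all)
  ultimately show "f x = 0"
    by (simp add: complex_eq_iff)
qed

end
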